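(* Let $\mathcal R_0$ be the ergodic p.m.p. hyperfinite equivalence relation on a standard probability space $(X,\mu)$. Then all $[\mathcal R_0]$-orbits are meager in $\mathrm{Sub}(\mathcal R_0)$.
   Context: Standard probability spaces are atomless. A p.m.p. equivalence relation $\mathcal R$ on $(X,\mu)$ is the orbit equivalence relation of a measure-preserving Borel action of a countable group on $(X,\mu)$. It is ergodic if every $\mathcal R$-invariant Borel set is null or conull, and hyperfinite if on a conull set it is an increasing union of Borel equivalence relations with finite classes; up to isomorphism there is a unique ergodic hyperfinite p.m.p. equivalence relation, denoted $\mathcal R_0$. Everything is considered up to null sets. Equip $\mathcal R$ with the measure $M(A)=\int_X|A_x|\,d\mu(x)$, where $A_x=\{y:(x,y)\in A\}$; $\mathrm{MAlg}(\mathcal R,M)$ is the space of Borel subsets of $\mathcal R$ modulo $M$-null sets with the topology of the metric $d_m(A,B)=m(A\triangle B)$, for $m$ any finite measure equivalent to $M$ (the topology does not depend on $m$). $\mathrm{Sub}(\mathcal R)\subseteq\mathrm{MAlg}(\mathcal R,M)$ is the (closed, hence Polish) subspace of (classes of) Borel equivalence relations on $X$ contained in $\mathcal R$. The full group $[\mathcal R]$ consists of all measure-preserving automorphisms $T$ of $(X,\mu)$ (mod null sets) with $(x,T(x))\in\mathcal R$ for almost every $x$; it acts on $\mathrm{Sub}(\mathcal R)$ by $T\cdot\mathcal S=(T\times T)(\mathcal S)$. *)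

theory Defs
  imports "HOL-Probability.Probability" "HOL-Algebra.Group_Action"
begin

section \<open>Standard probability spaces\<close>

definition standard_borel_measure :: "'a measure \<Rightarrow> bool" where
  "standard_borel_measure M \<longleftrightarrow>
     (\<exists>T. topspace T = space M \<and> completely_metrizable_space T \<and> second_countable T \<and>
          sets M = sigma_sets (space M) {U. openin T U})"

definition atomless :: "'a measure \<Rightarrow> bool" where
  "atomless M \<longleftrightarrow>
     (\<forall>A\<in>sets M. emeasure M A > 0 \<longrightarrow>
        (\<exists>B\<in>sets M. B \<subseteq> A \<and> 0 < emeasure M B \<and> emeasure M B < emeasure M A))"

definition standard_prob_space :: "'a measure \<Rightarrow> bool" where
  "standard_prob_space M \<longleftrightarrow> prob_space M \<and> standard_borel_measure M \<and> atomless M"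

definition mp_automorphism :: "'a measure \<Rightarrow> ('a \<Rightarrow> 'a) \<Rightarrow> bool" where
  "mp_automorphism M T \<longleftrightarrow>
     bij_betw T (space M) (space M) \<and> T \<in> measurable M M \<and>
     inv_into (space M) T \<in> measurable M M \<and> distr M M T = M"


section \<open>Equivalence relations on a probability space\<close>

text \<open>Every countable group is isomorphic to one whose carrier is a set of natural numbers, so
  the existential quantifier over groups of type \<open>nat monoid\<close> covers all countable groups.\<close>

definition pmp_equiv_rel :: "'a measure \<Rightarrow> ('a \<times> 'a) set \<Rightarrow> bool" where
  "pmp_equiv_rel M R \<longleftrightarrow>
     (\<exists>(G :: nat monoid) \<phi>. group_action G (space M) \<phi> \<and>
        (\<forall>g\<in>carrier G. mp_automorphism M (\<phi> g)) \<and>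
        R = {(x, y). x \<in> space M \<and> y \<in> orbit G \<phi> x})"

definition borel_equiv_rel_on :: "'a measure \<Rightarrow> 'a set \<Rightarrow> ('a \<times> 'a) set \<Rightarrow> bool" where
  "borel_equiv_rel_on M Y S \<longleftrightarrow> S \<in> sets (M \<Otimes>\<^sub>M M) \<and> equiv Y S"

definition ergodic_rel :: "'a measure \<Rightarrow> ('a \<times> 'a) set \<Rightarrow> bool" where
  "ergodic_rel M R \<longleftrightarrow>
     (\<forall>A\<in>sets M. R `` A = A \<longrightarrow> A \<in> null_sets M \<or> space M - A \<in> null_sets M)"

definition hyperfinite_rel :: "'a measure \<Rightarrow> ('a \<times> 'a) set \<Rightarrow> bool" where
  "hyperfinite_rel M R \<longleftrightarrow>
     (\<exists>Y\<in>sets M. space M - Y \<in> null_sets M \<and>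
        (\<exists>F :: nat \<Rightarrow> ('a \<times> 'a) set.
           (\<forall>n. borel_equiv_rel_on M Y (F n) \<and> (\<forall>x\<in>Y. finite (F n `` {x}))) \<and>
           incseq F \<and> (\<Union>n. F n) = R \<inter> (Y \<times> Y)))"


section \<open>Measure algebras\<close>

definition null_diff_rel :: "'b measure \<Rightarrow> ('b set \<times> 'b set) set" where
  "null_diff_rel N = {(A, B). A \<in> sets N \<and> B \<in> sets N \<and> sym_diff A B \<in> null_sets N}"

definition malg :: "'b measure \<Rightarrow> 'b set set set" where
  "malg N = sets N // null_diff_rel N"

text \<open>When \<open>m\<close> is a measure with the same null sets as \<open>N\<close>, the distance of two elements of
  \<open>malg N\<close> does not depend on the chosen representatives.\<close>

definition malg_dist :: "'b measure \<Rightarrow> 'b set set \<Rightarrow> 'b set set \<Rightarrow> real" where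
  "malg_dist m a b = measure m (sym_diff (SOME A. A \<in> a) (SOME B. B \<in> b))"

definition malg_topology :: "'b measure \<Rightarrow> 'b measure \<Rightarrow> 'b set set topology" where
  "malg_topology N m = Metric_space.mtopology (malg N) (malg_dist m)"


section \<open>The space of subrelations and the full group\<close>

definition rel_measure :: "'a measure \<Rightarrow> ('a \<times> 'a) set \<Rightarrow> ('a \<times> 'a) measure" where
  "rel_measure M R =
     measure_of R {A \<in> sets (M \<Otimes>\<^sub>M M). A \<subseteq> R}
       (\<lambda>A. \<integral>\<^sup>+ x. emeasure (count_space UNIV) (A `` {x}) \<partial>M)"

definition Sub_rel :: "'a measure \<Rightarrow> ('a \<times> 'a) set \<Rightarrow> ('a \<times> 'a) set set set" where
  "Sub_rel M R =
     {null_diff_rel (rel_measure M R) `` {S} | S. borel_equiv_rel_on M (space M) S \<and> S \<subseteq> R}"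

definition Sub_topology ::
    "'a measure \<Rightarrow> ('a \<times> 'a) set \<Rightarrow> ('a \<times> 'a) measure \<Rightarrow> ('a \<times> 'a) set set topology" where
  "Sub_topology M R m = subtopology (malg_topology (rel_measure M R) m) (Sub_rel M R)"

text \<open>Elements of the full group are given by representatives that are Borel automorphisms of the
  whole space. Representatives that agree almost everywhere act in the same way on classes.\<close>

definition full_group :: "'a measure \<Rightarrow> ('a \<times> 'a) set \<Rightarrow> ('a \<Rightarrow> 'a) set" where
  "full_group M R = {T. mp_automorphism M T \<and> (AE x in M. (x, T x) \<in> R)}"

text \<open>Since \<open>(x, T x) \<in> R\<close> is only required almost everywhere, the image of a subset of \<open>R\<close>
  under \<open>T \<times> T\<close> may leave \<open>R\<close>, but only over a null set of points; hence the
  intersection with \<open>R\<close>. The union is over equal classes.\<close>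

definition full_group_act ::
    "'a measure \<Rightarrow> ('a \<times> 'a) set \<Rightarrow> ('a \<Rightarrow> 'a) \<Rightarrow> ('a \<times> 'a) set set \<Rightarrow> ('a \<times> 'a) set set" where
  "full_group_act M R T s =
     (\<Union>S\<in>s. null_diff_rel (rel_measure M R) `` {map_prod T T ` S \<inter> R})"

definition full_group_orbit ::
    "'a measure \<Rightarrow> ('a \<times> 'a) set \<Rightarrow> ('a \<times> 'a) set set \<Rightarrow> ('a \<times> 'a) set set set" where
  "full_group_orbit M R s = (\<lambda>T. full_group_act M R T s) ` full_group M R"


section \<open>Meager sets\<close>

definition nowhere_dense_in :: "'b topology \<Rightarrow> 'b set \<Rightarrow> bool" where
  "nowhere_dense_in T A \<longleftrightarrow> A \<subseteq> topspace T \<and> T interior_of (T closure_of A) = {}"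

definition meager_in :: "'b topology \<Rightarrow> 'b set \<Rightarrow> bool" where
  "meager_in T A \<longleftrightarrow> (\<exists>C :: nat \<Rightarrow> 'b set. (\<forall>n. nowhere_dense_in T (C n)) \<and> A = (\<Union>n. C n))"

end

theory Submission
  imports Defs
begin

text \<open>Exhaust \<open>R\<^sub>0\<close> by finite relations \<open>F\<^sub>n\<close>. For a scale \<open>t > 0\<close> let the thickness of \<open>S\<close> in
  \<open>F\<^sub>n\<close> be the integral of \<open>min 1 (r / t)\<close>, where \<open>r x\<close> is the proportion of the
  \<open>F\<^sub>n\<close>-class of \<open>x\<close> taken up by the \<open>S\<close>-class of \<open>x\<close>. An element of the full group preserves
  almost every \<open>F\<^sub>n\<close>-class up to a small proportion once \<open>n\<close> is large, so along an orbit the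
  thickness in \<open>F\<^sub>n\<close> is asymptotically constant, with an error that does not depend on \<open>t\<close>.
  On the other hand, prescribing \<open>S\<close> on some \<open>F\<^sub>k\<close>, which is what a neighbourhood does,
  leaves the thickness free: one extension has finite classes and hence thickness
  tending to \<open>0\<close>, while another one has countably many classes and hence thickness close to \<open>1\<close>
  for small \<open>t\<close>. Therefore the part of an orbit on which the asymptotics have set in from a
  fixed \<open>N\<close> on is nowhere dense.\<close>

section \<open>Measure-preserving automorphisms and separating sequences\<close>

text \<open>The scale \<open>t\<close> has to be chosen last. The trace of \<open>S\<^sub>1\<close>
  on \<open>F k\<close> may cut an \<open>F k\<close>-class into a great many pieces; an extension
  with large classes then needs as many colours, and at a scale fixed beforehand its thickness need
  not be near 1. Only when a number of colours is known that suffices off a small set can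
  \<open>t\<close> be taken small against it. By then the piece of the orbit is already fixed, so
  the error along the orbit must not depend on \<open>t\<close>. The truncation achieves this:
  \<open>min 1 (u * (1 - l))\<close> is at least \<open>min 1 u - l\<close> for all
  \<open>u \<ge> 0\<close> and \<open>0 \<le> l \<le> 1\<close>, so the factor \<open>1 / t\<close>
  never multiplies the loss \<open>l\<close>. Nowhere density does not require knowing the thickness
  of the given relation. At one large \<open>n\<close> the two extensions have thicknesses so far
  apart that they cannot both be limits of the same piece; whichever is not a limit has positive
  distance from it. This uses that for fixed \<open>n\<close> and \<open>t\<close> the thickness is
  continuous along fast convergent sequences.\<close>

lemma standard_borel_separating:
  assumes "standard_borel_measure M"
  obtains B :: "nat \<Rightarrow> 'a set" where "\<And>i. B i \<in> sets M"
    and "\<And>x y. x \<in> space M \<Longrightarrow> y \<in> space M \<Longrightarrow> x \<noteq> y \<Longrightarrow> \<exists>i. x \<in> B i \<and> y \<notin> B i"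
proof -
  obtain T where T: "topspace T = space M" "completely_metrizable_space T" "second_countable T"
    "sets M = sigma_sets (space M) {U. openin T U}"
    using assms unfolding standard_borel_measure_def by blast
  have H: "Hausdorff_space T"
    using T(2) by (simp add: completely_metrizable_imp_metrizable_space metrizable_imp_Hausdorff_space)
  obtain \<B> where \<B>: "countable \<B>" "\<And>V. V \<in> \<B> \<Longrightarrow> openin T V"
    "\<And>U x. openin T U \<Longrightarrow> x \<in> U \<Longrightarrow> \<exists>V\<in>\<B>. x \<in> V \<and> V \<subseteq> U"
    using T(3) unfolding second_countable_def by metis
  \<comment> \<open>The empty set makes the family nonempty, so that \<open>from_nat_into\<close>
    enumerates exactly it.\<close>
  define B where "B = from_nat_into (insert {} \<B>)"
  have rB: "range B = insert {} \<B>"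
    using \<B>(1) unfolding B_def by (simp add: range_from_nat_into)
  show ?thesis
  proof (rule that[of B])
    fix i
    have "B i \<in> insert {} \<B>" using rB by blast
    then have "openin T (B i)" using \<B>(2) by auto
    then show "B i \<in> sets M" using T(4) by auto
  next
    fix x y assume "x \<in> space M" "y \<in> space M" "x \<noteq> y"
    then obtain U V where U: "openin T U" "openin T V" "x \<in> U" "y \<in> V" "disjnt U V"
      using H T(1) unfolding Hausdorff_space_def by metis
    obtain W where "W \<in> \<B>" "x \<in> W" "W \<subseteq> U" using \<B>(3)[OF U(1,3)] by blast
    moreover have "y \<notin> W" using U \<open>W \<subseteq> U\<close> by (auto simp: disjnt_iff)
    ultimately show "\<exists>i. x \<in> B i \<and> y \<notin> B i" using rB by (metis insertI2 imageE)
  qed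
qed

lemma nn_integral_count_space_const_indicator:
  assumes "finite A" "A \<subseteq> S"
  shows "(\<integral>\<^sup>+ y. c * indicator A y \<partial>count_space S) = c * of_nat (card A)"
  using assms by (subst nn_integral_cmult_indicator) (auto simp: emeasure_count_space_finite)

lemma nn_integral_count_space_subset_nat:
  fixes f :: "nat \<Rightarrow> ennreal"
  shows "(\<integral>\<^sup>+ i. f i \<partial>count_space A) = (\<Sum>i. indicator A i * f i)"
proof (cases "A = UNIV")
  case True then show ?thesis by (simp add: nn_integral_count_space_nat)
next
  case False
  have "(\<integral>\<^sup>+ i. f i \<partial>count_space A) = (\<integral>\<^sup>+ i. f i * indicator A i \<partial>count_space UNIV)"
    by (simp add: nn_integral_restrict_space[symmetric] restrict_count_space)
  then show ?thesis by (simp add: nn_integral_count_space_nat mult.commute)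
qed

lemma mp_automorphismD:
  assumes "mp_automorphism M T"
  shows "bij_betw T (space M) (space M)" "T \<in> measurable M M"
    "inv_into (space M) T \<in> measurable M M" "distr M M T = M"
  using assms by (auto simp: mp_automorphism_def)

lemma mp_automorphism_nn_integral:
  assumes "mp_automorphism M T" "f \<in> borel_measurable M"
  shows "(\<integral>\<^sup>+ x. f (T x) \<partial>M) = (\<integral>\<^sup>+ x. f x \<partial>M)"
  using nn_integral_distr[of T M M f] mp_automorphismD[OF assms(1)] assms(2) by simp

lemma mp_automorphism_integral:
  assumes "mp_automorphism M T" "f \<in> borel_measurable M"
  shows "(\<integral> x. f (T x) \<partial>M) = (\<integral> x. f x \<partial>M :: real)"
  using integral_distr[of T M M f] mp_automorphismD[OF assms(1)] assms(2) by simp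

lemma mp_automorphism_measure_vimage:
  assumes "mp_automorphism M T" "A \<in> sets M"
  shows "emeasure M (T -` A \<inter> space M) = emeasure M A"
  using emeasure_distr[of T M M A] mp_automorphismD[OF assms(1)] assms(2) by simp

lemma mp_automorphism_AE:
  assumes T: "mp_automorphism M T" and P: "AE x in M. P x"
  shows "AE x in M. P (T x)"
proof -
  obtain N where N: "{x\<in>space M. \<not> P x} \<subseteq> N" "N \<in> null_sets M"
    using P unfolding eventually_ae_filter by blast
  have "T -` N \<inter> space M \<in> null_sets M"
    using mp_automorphism_measure_vimage[OF T null_setsD2[OF N(2)]] N(2) mp_automorphismD(2)[OF T]
    by (auto intro!: null_setsI)
  moreover have "{x\<in>space M. \<not> P (T x)} \<subseteq> T -` N \<inter> space M"
    using N(1) measurable_space[OF mp_automorphismD(2)[OF T]] by auto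
  ultimately show ?thesis unfolding eventually_ae_filter by blast
qed

lemma mp_automorphism_inv:
  assumes T: "mp_automorphism M T"
  shows "mp_automorphism M (inv_into (space M) T)"
proof -
  note D = mp_automorphismD[OF T]
  let ?S = "inv_into (space M) T"
  have S: "bij_betw ?S (space M) (space M)" using bij_betw_inv_into[OF D(1)] .
  have "x \<in> space M \<Longrightarrow> inv_into (space M) ?S x = T x" for x
    using inv_into_inv_into_eq[OF D(1)] by blast
  then have 1: "inv_into (space M) ?S \<in> measurable M M"
    using D(2) by (simp cong: measurable_cong)
  have "distr M M ?S = M"
  proof (rule measure_eqI)
    fix A assume "A \<in> sets (distr M M ?S)"
    then have A: "A \<in> sets M" by simp
    have "emeasure (distr M M ?S) A = emeasure M (?S -` A \<inter> space M)"
      using D(3) A by (simp add: emeasure_distr)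
    also have "\<dots> = emeasure M (T -` (?S -` A \<inter> space M) \<inter> space M)"
      by (rule mp_automorphism_measure_vimage[OF T measurable_sets[OF D(3) A], symmetric])
    also have "T -` (?S -` A \<inter> space M) \<inter> space M = A"
      using D(1) sets.sets_into_space[OF A]
      by (auto simp: bij_betw_def)
    finally show "emeasure (distr M M ?S) A = emeasure M A" .
  qed simp
  then show ?thesis unfolding mp_automorphism_def using S D(3) 1 by blast
qed

lemma emeasure_count_space_enn2real: "enn2real (emeasure (count_space UNIV) A) = real (card A)"
  by (cases "finite A") (auto simp: emeasure_count_space)

section \<open>Mass transport\<close>

text \<open>What remains of the group is a sequence of automorphisms, possibly with repetitions,
  whose graphs cover \<open>R\<close>. The sets \<open>B i\<close> stand for the standard Borel
  structure: they make the diagonal measurable and provide names for points.\<close>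

locale pmp_rel = prob_space M for M :: "'a measure" +
  fixes R :: "('a \<times> 'a) set" and \<psi> :: "nat \<Rightarrow> 'a \<Rightarrow> 'a" and B :: "nat \<Rightarrow> 'a set"
  assumes B_sets [measurable]: "\<And>i. B i \<in> sets M"
    and B_sep: "\<And>x y. x \<in> space M \<Longrightarrow> y \<in> space M \<Longrightarrow> x \<noteq> y \<Longrightarrow> \<exists>i. x \<in> B i \<and> y \<notin> B i"
    and aut: "\<And>g. mp_automorphism M (\<psi> g)"
    and R_eq: "R = {(x, \<psi> g x) | x g. x \<in> space M}"
    and equiv_R: "equiv (space M) R"
begin

lemma psi_measurable [measurable]: "\<psi> g \<in> measurable M M"
  using mp_automorphismD[OF aut] by simp

lemma psi_space [simp]: "x \<in> space M \<Longrightarrow> \<psi> g x \<in> space M"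
  using measurable_space[OF psi_measurable] .

definition \<psi>i where "\<psi>i g = inv_into (space M) (\<psi> g)"

lemma psii_measurable [measurable]: "\<psi>i g \<in> measurable M M"
  using mp_automorphismD[OF aut] unfolding \<psi>i_def by simp

lemma psii_space [simp]: "x \<in> space M \<Longrightarrow> \<psi>i g x \<in> space M"
  using measurable_space[OF psii_measurable] .

lemma psi_psii [simp]: "x \<in> space M \<Longrightarrow> \<psi> g (\<psi>i g x) = x"
  and psii_psi [simp]: "x \<in> space M \<Longrightarrow> \<psi>i g (\<psi> g x) = x"
  using mp_automorphismD(1)[OF aut, of g] unfolding \<psi>i_def
  by (auto simp: bij_betw_inv_into_right bij_betw_inv_into_left)

text \<open>Two points are equal iff they lie in the same sets \<open>B i\<close>, so equality is a
  countable conjunction of measurable conditions.\<close>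

lemma pred_eq [measurable]:
  assumes [measurable]: "f \<in> measurable N M" "h \<in> measurable N M"
  shows "Measurable.pred N (\<lambda>x. f x = h x)"
proof -
  have "f x = h x \<longleftrightarrow> (\<forall>i. f x \<in> B i \<longleftrightarrow> h x \<in> B i)" if "x \<in> space N" for x
    using B_sep[of "f x" "h x"] measurable_space[OF assms(1) that] measurable_space[OF assms(2) that]
    by auto
  then show ?thesis by (simp cong: measurable_cong)
qed

lemma R_sets [measurable]: "R \<in> sets (M \<Otimes>\<^sub>M M)"
proof -
  have "R = {p \<in> space (M \<Otimes>\<^sub>M M). \<exists>g. \<psi> g (fst p) = snd p}"
    unfolding R_eq by (auto simp: space_pair_measure)
  also have "\<dots> \<in> sets (M \<Otimes>\<^sub>M M)" by measurable
  finally show ?thesis .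
qed

lemma R_iff: "(x, y) \<in> R \<longleftrightarrow> x \<in> space M \<and> (\<exists>g. y = \<psi> g x)"
  unfolding R_eq by auto

lemma R_sym: "(x, y) \<in> R \<Longrightarrow> (y, x) \<in> R"
  using equiv_R by (auto simp: equiv_def sym_def)

lemma R_trans: "(x, y) \<in> R \<Longrightarrow> (y, z) \<in> R \<Longrightarrow> (x, z) \<in> R"
  using equiv_R unfolding equiv_def trans_def by blast

lemma R_refl: "x \<in> space M \<Longrightarrow> (x, x) \<in> R"
  using equiv_R by (auto simp: equiv_def refl_on_def)

lemma R_space: "(x, y) \<in> R \<Longrightarrow> x \<in> space M \<and> y \<in> space M"
  unfolding R_iff by auto

text \<open>The sets \<open>D g\<close> cut the graphs of the \<open>\<psi> g\<close> down to a partition of \<open>R\<close>.\<close>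

definition D where "D g = {x \<in> space M. \<forall>h<g. \<psi> h x \<noteq> \<psi> g x}"

lemma D_sets [measurable]: "D g \<in> sets M"
  unfolding D_def by measurable

lemma D_bij:
  assumes "x \<in> space M"
  shows "bij_betw (\<lambda>g. \<psi> g x) {g. x \<in> D g} (R `` {x})"
proof (rule bij_betwI')
  fix g h assume "g \<in> {g. x \<in> D g}" "h \<in> {g. x \<in> D g}"
  then show "\<psi> g x = \<psi> h x \<longleftrightarrow> g = h"
    by (cases g h rule: linorder_cases) (auto simp: D_def dest: spec)
next
  fix g assume "g \<in> {g. x \<in> D g}" then show "\<psi> g x \<in> R `` {x}" using assms by (auto simp: R_iff)
next
  fix y assume "y \<in> R `` {x}"
  then have ex: "\<exists>g. y = \<psi> g x" by (auto simp: R_iff)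
  define g where "g = (LEAST g. y = \<psi> g x)"
  have g: "y = \<psi> g x" unfolding g_def using ex by (rule LeastI_ex)
  have "y \<noteq> \<psi> h x" if "h < g" for h
    using not_less_Least[of h "\<lambda>g. y = \<psi> g x"] that unfolding g_def by blast
  then have "\<psi> h x \<noteq> \<psi> g x" if "h < g" for h using that g by metis
  then have "x \<in> D g" unfolding D_def using assms by simp
  then show "\<exists>g\<in>{g. x \<in> D g}. y = \<psi> g x" using g by auto
qed

text \<open>The piece with index \<open>g\<close> meets the column over \<open>y\<close> at most in
  \<open>\<psi>i g y\<close>, and does so iff this point lies in \<open>D g\<close>. A point reached
  with two such indices would be sent to \<open>y\<close> by both, against \<open>D_bij\<close>. By
  symmetry of \<open>R\<close> the column is the class of \<open>y\<close>.\<close>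

lemma D_bij_inv:
  assumes "y \<in> space M"
  shows "bij_betw (\<lambda>g. \<psi>i g y) {g. \<psi>i g y \<in> D g} (R `` {y})"
proof (rule bij_betwI')
  fix g h assume gh: "g \<in> {g. \<psi>i g y \<in> D g}" "h \<in> {g. \<psi>i g y \<in> D g}"
  show "\<psi>i g y = \<psi>i h y \<longleftrightarrow> g = h"
  proof
    assume e: "\<psi>i g y = \<psi>i h y"
    have "\<psi> g (\<psi>i h y) = \<psi> h (\<psi>i h y)"
      using assms psi_psii[of y h] psi_psii[of y g] e by simp
    moreover have "inj_on (\<lambda>k. \<psi> k (\<psi>i h y)) {k. \<psi>i h y \<in> D k}"
      using D_bij[of "\<psi>i h y"] assms by (simp add: bij_betw_def)
    moreover have "\<psi>i h y \<in> D g" using gh(1) e by simp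
    ultimately show "g = h" using gh(2) by (simp add: inj_on_def)
  qed simp
next
  fix g assume "g \<in> {g. \<psi>i g y \<in> D g}"
  have "(\<psi>i g y, y) \<in> R" using assms psi_psii[of y g] unfolding R_iff by (auto intro!: exI[of _ g])
  then show "\<psi>i g y \<in> R `` {y}" using R_sym by auto
next
  fix x assume "x \<in> R `` {y}"
  then have "(x, y) \<in> R" using R_sym by auto
  then have "x \<in> space M" "y \<in> R `` {x}" using R_space by auto
  then obtain g where "x \<in> D g" "y = \<psi> g x"
    using D_bij[of x] unfolding bij_betw_def by blast
  then show "\<exists>g\<in>{g. \<psi>i g y \<in> D g}. x = \<psi>i g y"
    using \<open>x \<in> space M\<close> by (intro bexI[of _ g]) auto
qed

text \<open>A sum over a class that varies with \<open>x\<close> becomes a series over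
  \<open>nat\<close> whose terms are measurable in \<open>x\<close>.\<close>

lemma row_integral:
  assumes "x \<in> space M"
  shows "(\<integral>\<^sup>+ y. f (x, y) \<partial>count_space (R `` {x})) = (\<Sum>g. indicator (D g) x * f (x, \<psi> g x))"
proof -
  have "(\<integral>\<^sup>+ y. f (x, y) \<partial>count_space (R `` {x}))
      = (\<integral>\<^sup>+ g. f (x, \<psi> g x) \<partial>count_space {g. x \<in> D g})"
    using nn_integral_bij_count_space[OF D_bij[OF assms], of "\<lambda>y. f (x, y)"] by simp
  also have "\<dots> = (\<Sum>g. indicator (D g) x * f (x, \<psi> g x))"
    unfolding nn_integral_count_space_subset_nat
    by (intro arg_cong[where f=suminf] ext) (auto simp: indicator_def)
  finally show ?thesis .
qed

lemma column_integral:
  assumes "y \<in> space M"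
  shows "(\<integral>\<^sup>+ x. f (x, y) \<partial>count_space (R `` {y})) =
    (\<Sum>g. indicator (D g) (\<psi>i g y) * f (\<psi>i g y, y))"
proof -
  have "(\<integral>\<^sup>+ x. f (x, y) \<partial>count_space (R `` {y}))
      = (\<integral>\<^sup>+ g. f (\<psi>i g y, y) \<partial>count_space {g. \<psi>i g y \<in> D g})"
    using nn_integral_bij_count_space[OF D_bij_inv[OF assms], of "\<lambda>x. f (x, y)"] by simp
  also have "\<dots> = (\<Sum>g. indicator (D g) (\<psi>i g y) * f (\<psi>i g y, y))"
    unfolding nn_integral_count_space_subset_nat
    by (intro arg_cong[where f=suminf] ext) (auto simp: indicator_def)
  finally show ?thesis .
qed

lemma row_integral_measurable:
  assumes [measurable]: "f \<in> borel_measurable (M \<Otimes>\<^sub>M M)"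
  shows "(\<lambda>x. \<integral>\<^sup>+ y. f (x, y) \<partial>count_space (R `` {x})) \<in> borel_measurable M"
proof -
  have "(\<lambda>x. \<Sum>g. indicator (D g) x * f (x, \<psi> g x)) \<in> borel_measurable M"
    by measurable
  then show ?thesis by (simp add: row_integral cong: measurable_cong)
qed

text \<open>On each graph piece the row and the column integral are related by the substitution
  \<open>y = \<psi> g x\<close>, which preserves the measure; summing over \<open>g\<close> gives
  the claim.\<close>

lemma mass_transport:
  assumes [measurable]: "f \<in> borel_measurable (M \<Otimes>\<^sub>M M)"
  shows "(\<integral>\<^sup>+ x. (\<integral>\<^sup>+ y. f (x, y) \<partial>count_space (R `` {x})) \<partial>M) =
    (\<integral>\<^sup>+ y. (\<integral>\<^sup>+ x. f (x, y) \<partial>count_space (R `` {y})) \<partial>M)"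
proof -
  have "(\<integral>\<^sup>+ x. (\<integral>\<^sup>+ y. f (x, y) \<partial>count_space (R `` {x})) \<partial>M)
      = (\<integral>\<^sup>+ x. (\<Sum>g. indicator (D g) x * f (x, \<psi> g x)) \<partial>M)"
    by (intro nn_integral_cong) (simp add: row_integral)
  also have "\<dots> = (\<Sum>g. \<integral>\<^sup>+ x. indicator (D g) x * f (x, \<psi> g x) \<partial>M)"
    by (rule nn_integral_suminf) measurable
  also have "\<dots> = (\<Sum>g. \<integral>\<^sup>+ y. indicator (D g) (\<psi>i g y) * f (\<psi>i g y, y) \<partial>M)"
  proof (intro arg_cong[where f=suminf] ext)
    fix g
    have "(\<integral>\<^sup>+ y. indicator (D g) (\<psi>i g y) * f (\<psi>i g y, y) \<partial>M)
      = (\<integral>\<^sup>+ x. indicator (D g) (\<psi>i g (\<psi> g x)) * f (\<psi>i g (\<psi> g x), \<psi> g x) \<partial>M)"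
      by (rule mp_automorphism_nn_integral[OF aut, symmetric]) measurable
    also have "\<dots> = (\<integral>\<^sup>+ x. indicator (D g) x * f (x, \<psi> g x) \<partial>M)"
      by (intro nn_integral_cong) simp
    finally show "(\<integral>\<^sup>+ x. indicator (D g) x * f (x, \<psi> g x) \<partial>M)
      = (\<integral>\<^sup>+ y. indicator (D g) (\<psi>i g y) * f (\<psi>i g y, y) \<partial>M)" by simp
  qed
  also have "\<dots> = (\<integral>\<^sup>+ y. (\<Sum>g. indicator (D g) (\<psi>i g y) * f (\<psi>i g y, y)) \<partial>M)"
    by (rule nn_integral_suminf[symmetric]) measurable
  also have "\<dots> = (\<integral>\<^sup>+ y. (\<integral>\<^sup>+ x. f (x, y) \<partial>count_space (R `` {y})) \<partial>M)"
    by (intro nn_integral_cong) (simp add: column_integral)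
  finally show ?thesis .
qed

section \<open>The counting measure on \<open>R\<close>\<close>

lemma emeasure_section:
  assumes "A \<subseteq> R"
  shows "emeasure (count_space UNIV) (A `` {x}) = (\<integral>\<^sup>+ y. indicator A (x, y) \<partial>count_space (R `` {x}))"
proof -
  have "(\<integral>\<^sup>+ y. indicator A (x, y) \<partial>count_space (R `` {x}))
      = (\<integral>\<^sup>+ y. indicator (A `` {x}) y \<partial>count_space (R `` {x}))"
    by (intro nn_integral_cong) (auto simp: indicator_def)
  also have "\<dots> = emeasure (count_space (R `` {x})) (A `` {x})"
    using assms by (intro nn_integral_indicator) auto
  also have "\<dots> = emeasure (count_space UNIV) (A `` {x})"
    using assms by (subst (1 2) emeasure_count_space) auto
  finally show ?thesis by simp
qed

lemma emeasure_section_measurable: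
  assumes [measurable]: "A \<in> sets (M \<Otimes>\<^sub>M M)" and "A \<subseteq> R"
  shows "(\<lambda>x. emeasure (count_space UNIV) (A `` {x})) \<in> borel_measurable M"
  unfolding emeasure_section[OF assms(2)] by (rule row_integral_measurable) measurable

lemma card_section_measurable:
  assumes "A \<in> sets (M \<Otimes>\<^sub>M M)" "A \<subseteq> R"
  shows "(\<lambda>x. real (card (A `` {x}))) \<in> borel_measurable M"
  using emeasure_section_measurable[OF assms]
  unfolding emeasure_count_space_enn2real[symmetric] by measurable

lemma rel_measure_space_sets:
  "space (rel_measure M R) = R" "sets (rel_measure M R) = {A \<in> sets (M \<Otimes>\<^sub>M M). A \<subseteq> R}"
proof -
  have sa: "sigma_algebra R {A \<in> sets (M \<Otimes>\<^sub>M M). A \<subseteq> R}"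
  proof -
    have "{A \<in> sets (M \<Otimes>\<^sub>M M). A \<subseteq> R} = sets (restrict_space (M \<Otimes>\<^sub>M M) R)"
      using sets_restrict_space_iff[of R "M \<Otimes>\<^sub>M M"] R_sets by auto
    moreover have "space (restrict_space (M \<Otimes>\<^sub>M M) R) = R"
      using sets.sets_into_space[OF R_sets] by (auto simp: space_restrict_space)
    ultimately show ?thesis using sets.sigma_algebra_axioms[of "restrict_space (M \<Otimes>\<^sub>M M) R"] by simp
  qed
  show "space (rel_measure M R) = R" unfolding rel_measure_def by (rule space_measure_of) auto
  show "sets (rel_measure M R) = {A \<in> sets (M \<Otimes>\<^sub>M M). A \<subseteq> R}"
    unfolding rel_measure_def using sigma_algebra.sets_measure_of_eq[OF sa] .
qed

text \<open>\<open>measure_of\<close> takes the prescribed values only once they are known to be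
  countably additive. Counting measures of disjoint sections add up, and measurability of the
  section counts lets sum and integral be exchanged.\<close>

lemma rel_measure_emeasure:
  assumes A: "A \<in> sets (M \<Otimes>\<^sub>M M)" "A \<subseteq> R"
  shows "emeasure (rel_measure M R) A = (\<integral>\<^sup>+ x. emeasure (count_space UNIV) (A `` {x}) \<partial>M)"
proof (rule emeasure_measure_of[OF rel_measure_def])
  show "{A \<in> sets (M \<Otimes>\<^sub>M M). A \<subseteq> R} \<subseteq> Pow R" by auto
  show "A \<in> sets (rel_measure M R)" using A by (simp add: rel_measure_space_sets)
  show "positive (sets (rel_measure M R)) (\<lambda>A. \<integral>\<^sup>+ x. emeasure (count_space UNIV) (A `` {x}) \<partial>M)"
    by (simp add: positive_def)
  show "countably_additive (sets (rel_measure M R)) (\<lambda>A. \<integral>\<^sup>+ x. emeasure (count_space UNIV) (A `` {x}) \<partial>M)"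
  proof (rule countably_additiveI)
    fix A :: "nat \<Rightarrow> ('a \<times> 'a) set"
    assume "range A \<subseteq> sets (rel_measure M R)" and dis: "disjoint_family A"
    then have A: "\<And>i. A i \<in> sets (M \<Otimes>\<^sub>M M)" "\<And>i. A i \<subseteq> R" by (auto simp: rel_measure_space_sets)
    have "(\<Sum>i. emeasure (count_space UNIV) (A i `` {x})) = emeasure (count_space UNIV) ((\<Union>i. A i) `` {x})" for x
    proof -
      have "disjoint_family (\<lambda>i. A i `` {x})" using dis by (fastforce simp: disjoint_family_on_def)
      then have "(\<Sum>i. emeasure (count_space UNIV) (A i `` {x})) = emeasure (count_space UNIV) (\<Union>i. A i `` {x})"
        by (intro suminf_emeasure) auto
      moreover have "(\<Union>i. A i `` {x}) = (\<Union>i. A i) `` {x}" by auto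
      ultimately show ?thesis by simp
    qed
    moreover have "(\<lambda>x. emeasure (count_space UNIV) (A i `` {x})) \<in> borel_measurable M" for i
      by (rule emeasure_section_measurable[OF A])
    ultimately show "(\<Sum>i. \<integral>\<^sup>+ x. emeasure (count_space UNIV) (A i `` {x}) \<partial>M) =
        (\<integral>\<^sup>+ x. emeasure (count_space UNIV) ((\<Union>i. A i) `` {x}) \<partial>M)"
      by (subst nn_integral_suminf[symmetric]) simp_all
  qed
qed

text \<open>The finite measure \<open>m\<close> is tied to \<open>R\<close> only by its null sets;
  this criterion turns \<open>m\<close>-null sets into statements about almost every
  section.\<close>

lemma rel_measure_null_iff:
  "A \<in> null_sets (rel_measure M R) \<longleftrightarrow>
    A \<in> sets (M \<Otimes>\<^sub>M M) \<and> A \<subseteq> R \<and> (AE x in M. A `` {x} = {})"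
proof -
  have "(AE x in M. emeasure (count_space UNIV) (A `` {x}) = 0) \<longleftrightarrow> (AE x in M. A `` {x} = {})"
    by (simp add: emeasure_count_space_eq_0)
  moreover have "(\<integral>\<^sup>+ x. emeasure (count_space UNIV) (A `` {x}) \<partial>M) = 0 \<longleftrightarrow>
      (AE x in M. emeasure (count_space UNIV) (A `` {x}) = 0)"
    if "A \<in> sets (M \<Otimes>\<^sub>M M)" "A \<subseteq> R"
    using emeasure_section_measurable[OF that] by (rule nn_integral_0_iff_AE)
  ultimately show ?thesis
    by (auto simp: null_sets_def rel_measure_space_sets rel_measure_emeasure)
qed

section \<open>Averages over finite subrelations\<close>

definition finite_subrel where
  "finite_subrel C \<longleftrightarrow> C \<in> sets (M \<Otimes>\<^sub>M M) \<and> C \<subseteq> R \<and> equiv (space M) C \<and> (\<forall>x\<in>space M. finite (C `` {x}))"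

lemma finite_subrelD:
  assumes "finite_subrel C"
  shows "C \<in> sets (M \<Otimes>\<^sub>M M)" "C \<subseteq> R" "equiv (space M) C" "\<And>x. finite (C `` {x})"
proof -
  show 1: "C \<in> sets (M \<Otimes>\<^sub>M M)" "C \<subseteq> R" "equiv (space M) C" using assms by (auto simp: finite_subrel_def)
  show "finite (C `` {x})" for x
  proof (cases "x \<in> space M")
    case False
    then have "C `` {x} = {}" using 1(2) R_space by auto
    then show ?thesis by simp
  qed (use assms in \<open>auto simp: finite_subrel_def\<close>)
qed

lemma average_integral_aux:
  assumes C: "finite_subrel C" and A [measurable]: "A \<in> sets M"
  shows "(\<integral>\<^sup>+ x. ennreal (card (C `` {x} \<inter> A) / card (C `` {x})) \<partial>M) = emeasure M A"
proof -
  note FC = finite_subrelD[OF C]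
  note [measurable] = FC(1)
  have cm: "(\<lambda>x. real (card (C `` {x}))) \<in> borel_measurable M"
    by (rule card_section_measurable[OF FC(1,2)])
  note [measurable] = measurable_compose[OF measurable_fst cm]
  define f where "f p = ennreal (1 / real (card (C `` {fst p}))) * indicator A (snd p) * indicator C p" for p
  have [measurable]: "f \<in> borel_measurable (M \<Otimes>\<^sub>M M)"
    unfolding f_def by measurable
  have 1: "(\<integral>\<^sup>+ y. f (x, y) \<partial>count_space (R `` {x})) = ennreal (card (C `` {x} \<inter> A) / card (C `` {x}))" for x
  proof -
    have "(\<integral>\<^sup>+ y. f (x, y) \<partial>count_space (R `` {x})) =
      (\<integral>\<^sup>+ y. ennreal (1 / real (card (C `` {x}))) * indicator (C `` {x} \<inter> A) y \<partial>count_space (R `` {x}))"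
      by (intro nn_integral_cong) (auto simp: f_def indicator_def)
    also have "\<dots> = ennreal (1 / real (card (C `` {x}))) * of_nat (card (C `` {x} \<inter> A))"
      using FC by (intro nn_integral_count_space_const_indicator) auto
    also have "\<dots> = ennreal (card (C `` {x} \<inter> A) / card (C `` {x}))"
      by (simp add: ennreal_of_nat_eq_real_of_nat ennreal_mult'[symmetric])
    finally show ?thesis .
  qed
  have 2: "(\<integral>\<^sup>+ x. f (x, y) \<partial>count_space (R `` {y})) = indicator A y" if y: "y \<in> space M" for y
  proof -
    have e: "C `` {x} = C `` {y}" if "(x, y) \<in> C" for x
      using equiv_class_eq[OF FC(3) that] .
    have s: "(x, y) \<in> C \<longleftrightarrow> (y, x) \<in> C" for x
      using FC(3) by (auto simp: equiv_def sym_def)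
    have "(\<integral>\<^sup>+ x. f (x, y) \<partial>count_space (R `` {y})) =
      (\<integral>\<^sup>+ x. (ennreal (1 / real (card (C `` {y}))) * indicator A y) * indicator (C `` {y}) x \<partial>count_space (R `` {y}))"
    proof (intro nn_integral_cong)
      fix x
      show "f (x, y) = ennreal (1 / real (card (C `` {y}))) * indicator A y * indicator (C `` {y}) x"
        using e[of x] s[of x] by (cases "(x, y) \<in> C") (simp_all add: f_def)
    qed
    also have "\<dots> = (ennreal (1 / real (card (C `` {y}))) * indicator A y) * of_nat (card (C `` {y}))"
      using FC by (intro nn_integral_count_space_const_indicator) auto
    also have "\<dots> = indicator A y"
    proof -
      have "y \<in> C `` {y}" using equiv_class_self[OF FC(3) y] .
      then have "card (C `` {y}) > 0" using FC(4) card_gt_0_iff by blast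
      then show ?thesis
        by (auto simp: indicator_def ennreal_of_nat_eq_real_of_nat ennreal_mult'[symmetric] split: if_splits)
    qed
    finally show ?thesis .
  qed
  have "(\<integral>\<^sup>+ x. ennreal (card (C `` {x} \<inter> A) / card (C `` {x})) \<partial>M)
      = (\<integral>\<^sup>+ x. (\<integral>\<^sup>+ y. f (x, y) \<partial>count_space (R `` {x})) \<partial>M)" by (simp add: 1)
  also have "\<dots> = (\<integral>\<^sup>+ y. (\<integral>\<^sup>+ x. f (x, y) \<partial>count_space (R `` {y})) \<partial>M)"
    by (rule mass_transport) measurable
  also have "\<dots> = (\<integral>\<^sup>+ y. indicator A y \<partial>M)" by (intro nn_integral_cong) (simp add: 2)
  finally show ?thesis by simp
qed

lemma average_measurable:
  assumes C: "finite_subrel C" and A [measurable]: "A \<in> sets M"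
  shows "(\<lambda>x. card (C `` {x} \<inter> A) / card (C `` {x}) :: real) \<in> borel_measurable M"
proof -
  note FC = finite_subrelD[OF C]
  note [measurable] = FC(1)
  have "C \<inter> (space M \<times> A) \<in> sets (M \<Otimes>\<^sub>M M)" by measurable
  moreover have "C `` {x} \<inter> A = (C \<inter> (space M \<times> A)) `` {x}" for x
    using FC(2) R_space by auto
  ultimately have [measurable]: "(\<lambda>x. real (card (C `` {x} \<inter> A))) \<in> borel_measurable M"
    using card_section_measurable[of "C \<inter> (space M \<times> A)"] FC(2) by auto
  note [measurable] = card_section_measurable[OF FC(1,2)]
  show ?thesis by measurable
qed

lemma card_ratio_le_1: "finite X \<Longrightarrow> card (X \<inter> Y) / card X \<le> (1::real)"
  by (cases "X = {}") (auto simp: divide_le_eq_1 card_gt_0_iff intro: card_mono)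

lemma average_integral:
  assumes C: "finite_subrel C" and A: "A \<in> sets M"
  shows "integrable M (\<lambda>x. card (C `` {x} \<inter> A) / card (C `` {x}) :: real)"
    "(\<integral> x. card (C `` {x} \<inter> A) / card (C `` {x}) \<partial>M) = measure M A"
proof -
  show "integrable M (\<lambda>x. card (C `` {x} \<inter> A) / card (C `` {x}) :: real)"
    by (rule integrable_const_bound[where B=1])
      (use average_measurable[OF C A] finite_subrelD(4)[OF C] in \<open>auto intro!: card_ratio_le_1\<close>)
  show "(\<integral> x. card (C `` {x} \<inter> A) / card (C `` {x}) \<partial>M) = measure M A"
    using average_measurable[OF C A]
    by (subst integral_eq_nn_integral) (auto simp: average_integral_aux[OF C A] measure_def)
qed

end

text \<open>If \<open>u \<le> 1\<close>, shrinking costs \<open>u * l\<close>, which is at most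
  \<open>l\<close>; if \<open>u > 1\<close>, then \<open>u * (1 - l)\<close> is still at least
  \<open>1 - l\<close>. With \<open>u = r / t\<close> this gives a loss that does not see
  \<open>t\<close>.\<close>

lemma min_one_shrink:
  fixes u l :: real
  assumes "0 \<le> u" "0 \<le> l" "l \<le> 1"
  shows "min 1 u - l \<le> min 1 (u * (1 - l))"
proof (cases "u \<le> 1")
  case True
  have "u * l \<le> 1 * l" using True assms by (intro mult_right_mono) auto
  then show ?thesis using True assms by (auto simp: algebra_simps min_def)
next
  case False
  have "1 * (1 - l) \<le> u * (1 - l)" using False assms by (intro mult_right_mono) auto
  then show ?thesis using False assms by (auto simp: min_def)
qed

text \<open>Splitting a set into \<open>C\<close> and \<open>A - C\<close>, both of positive
  measure, leaves one part with at most half of the measure.\<close>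

lemma atomless_small:
  assumes "prob_space M" "atomless M"
  shows "\<exists>A\<in>sets M. 0 < measure M A \<and> measure M A \<le> (1/2) ^ n"
proof -
  interpret prob_space M by fact
  show ?thesis
  proof (induction n)
    case 0
    show ?case by (intro bexI[of _ "space M"]) (auto simp: prob_space)
  next
    case (Suc n)
    then obtain A where A: "A \<in> sets M" "0 < measure M A" "measure M A \<le> (1/2)^n" by blast
    obtain C where C: "C \<in> sets M" "C \<subseteq> A" "0 < emeasure M C" "emeasure M C < emeasure M A"
      using assms(2) A unfolding atomless_def emeasure_eq_measure by force
    have "0 < measure M C" "measure M C < measure M A"
      using C by (auto simp: emeasure_eq_measure ennreal_less_iff)
    moreover have "measure M (A - C) = measure M A - measure M C"
      using A C by (simp add: finite_measure_Diff)
    ultimately show ?case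
    proof (cases "measure M C \<le> (1/2)^Suc n")
      case False
      then show ?thesis using A C \<open>measure M (A - C) = _\<close> \<open>measure M C < measure M A\<close>
        by (intro bexI[of _ "A - C"]) auto
    qed (use C in auto)
  qed
qed

lemma finite_subset_incseq_UN:
  fixes F :: "nat \<Rightarrow> 'b set"
  assumes "incseq F" "finite A" "A \<subseteq> (\<Union>n. F n)"
  shows "\<exists>n. A \<subseteq> F n"
  using assms(2,3)
proof (induction A)
  case (insert a A)
  then obtain i j where "A \<subseteq> F i" "a \<in> F j" by auto
  then have "insert a A \<subseteq> F (max i j)"
    using incseqD[OF assms(1), of i "max i j"] incseqD[OF assms(1), of j "max i j"] by auto
  then show ?case by blast
qed simp

lemma pred_eq_count_space [measurable]:
  assumes [measurable]: "f \<in> measurable N (count_space UNIV)" "g \<in> measurable N (count_space UNIV)"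
  shows "Measurable.pred N (\<lambda>x. f x = (g x :: nat))"
proof -
  have "Measurable.pred N (\<lambda>x. \<exists>i. f x = i \<and> g x = i)" by measurable
  also have "(\<lambda>x. \<exists>i. f x = i \<and> g x = i) = (\<lambda>x. f x = g x)" by auto
  finally show ?thesis .
qed

section \<open>Thickness\<close>

context pmp_rel
begin

definition rel_size :: "('a \<times> 'a) set \<Rightarrow> ('a \<times> 'a) set \<Rightarrow> 'a \<Rightarrow> real" where
  "rel_size S F x = real (card (S `` {x} \<inter> F `` {x})) / real (card (F `` {x}))"

definition thickness :: "real \<Rightarrow> ('a \<times> 'a) set \<Rightarrow> ('a \<times> 'a) set \<Rightarrow> real" where
  "thickness t S F = (\<integral>x. min 1 (rel_size S F x / t) \<partial>M)"

lemma integrable_indicator_sets: "A \<in> sets M \<Longrightarrow> integrable M (indicator A :: 'a \<Rightarrow> real)"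
  by (rule integrable_real_indicator) (simp_all add: less_top[symmetric])

lemma rel_size_nonneg: "0 \<le> rel_size S F x"
  by (simp add: rel_size_def)

lemma rel_size_measurable:
  assumes F: "finite_subrel F" and [measurable]: "S \<in> sets (M \<Otimes>\<^sub>M M)"
  shows "rel_size S F \<in> borel_measurable M"
proof -
  note FF = finite_subrelD[OF F]
  note [measurable] = FF(1)
  have *: "S `` {x} \<inter> F `` {x} = (S \<inter> F) `` {x}" for x by auto
  have [measurable]: "(\<lambda>x. real (card ((S \<inter> F) `` {x}))) \<in> borel_measurable M"
    using FF(2) by (intro card_section_measurable) auto
  note [measurable] = card_section_measurable[OF FF(1,2)]
  show ?thesis unfolding rel_size_def * by measurable
qed

lemma min_rel_size_integrable:
  assumes "finite_subrel F" "S \<in> sets (M \<Otimes>\<^sub>M M)" "0 < t"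
  shows "integrable M (\<lambda>x. min 1 (rel_size S F x / t))"
proof (rule integrable_const_bound[where B=1])
  note [measurable] = rel_size_measurable[OF assms(1,2)]
  show "(\<lambda>x. min 1 (rel_size S F x / t)) \<in> borel_measurable M" by measurable
  show "AE x in M. norm (min 1 (rel_size S F x / t)) \<le> 1"
    using assms(3) rel_size_nonneg by (auto simp: min_def)
qed

lemma finite_subrel_Int:
  assumes F: "finite_subrel F" and S: "S \<in> sets (M \<Otimes>\<^sub>M M)" "equiv (space M) S"
  shows "finite_subrel (S \<inter> F)"
proof -
  note FF = finite_subrelD[OF F]
  have "equiv (space M) (S \<inter> F)"
    using S(2) FF(3) unfolding equiv_def refl_on_def sym_def trans_def by blast
  moreover have "finite ((S \<inter> F) `` {x})" for x
    by (rule finite_subset[OF _ FF(4)[of x]]) auto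
  ultimately show ?thesis using FF S unfolding finite_subrel_def by auto
qed

text \<open>An element of the full group that stays in \<open>F\<close> off a set of measure \<open>e\<close> changes
  the thickness by at most \<open>2 e\<close>, uniformly in the scale \<open>t\<close>: a block losing the
  proportion \<open>l\<close> of its points loses at most \<open>l\<close> from the truncated relative size.\<close>

lemma thickness_stable:
  assumes F: "finite_subrel F" and S: "S \<in> sets (M \<Otimes>\<^sub>M M)" "equiv (space M) S"
    and T: "mp_automorphism M T" and Q: "Q \<in> sets (M \<Otimes>\<^sub>M M)"
    and QS: "\<And>x y. (x, y) \<in> S \<Longrightarrow> (T x, T y) \<in> F \<Longrightarrow> (T x, T y) \<in> Q" and t: "0 < t"
  shows "thickness t S F - 2 * measure M {x \<in> space M. (x, T x) \<notin> F} \<le> thickness t Q F"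
proof -
  note FF = finite_subrelD[OF F]
  note [measurable] = FF(1) mp_automorphismD(2)[OF T] rel_size_measurable[OF F Q] rel_size_measurable[OF F S(1)]
  define Z where "Z = {x \<in> space M. (x, T x) \<notin> F}"
  have Z [measurable]: "Z \<in> sets M" unfolding Z_def by measurable
  define C where "C = S \<inter> F"
  have C: "finite_subrel C" unfolding C_def by (rule finite_subrel_Int[OF F S])
  note CC = finite_subrelD[OF C]
  have pw: "min 1 (rel_size S F x / t) - indicator Z x - card (C `` {x} \<inter> Z) / card (C `` {x})
      \<le> min 1 (rel_size Q F (T x) / t)" if x: "x \<in> space M" for x
  proof (cases "x \<in> Z")
    case True
    have "min 1 (rel_size S F x / t) \<le> 1" "0 \<le> min 1 (rel_size Q F (T x) / t)"
      using t rel_size_nonneg by auto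
    moreover have "indicator Z x = (1::real)" "0 \<le> card (C `` {x} \<inter> Z) / real (card (C `` {x}))"
      using True by auto
    ultimately show ?thesis by linarith
  next
    case False
    then have xF: "(x, T x) \<in> F" using x by (simp add: Z_def)
    have Fe: "F `` {T x} = F `` {x}" using equiv_class_eq[OF FF(3) xF] by simp
    define n p b q where "n = real (card (F `` {x}))" and "p = real (card (C `` {x}))"
      and "b = real (card (C `` {x} \<inter> Z))" and "q = real (card (Q `` {T x} \<inter> F `` {T x}))"
    have "x \<in> F `` {x}" "x \<in> C `` {x}" using equiv_class_self x FF(3) CC(3) by fast+
    then have np: "n > 0" "p > 0" unfolding n_def p_def using FF(4) CC(4) by (auto simp: card_gt_0_iff)
    have b: "0 \<le> b" "b \<le> p" unfolding b_def p_def using CC(4) by (auto intro: card_mono)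
    have "T ` (C `` {x} - Z) \<subseteq> Q `` {T x} \<inter> F `` {T x}"
    proof
      fix w assume "w \<in> T ` (C `` {x} - Z)"
      then obtain y where y: "(x, y) \<in> S" "(x, y) \<in> F" "y \<notin> Z" "w = T y" by (auto simp: C_def)
      have "y \<in> space M" using y(2) FF(2) R_space by auto
      then have "(y, T y) \<in> F" using y(3) by (simp add: Z_def)
      then have "(T x, T y) \<in> F" using xF y(2) FF(3) unfolding equiv_def sym_def trans_def by blast
      then show "w \<in> Q `` {T x} \<inter> F `` {T x}" using QS[OF y(1)] y(4) by auto
    qed
    then have "card (T ` (C `` {x} - Z)) \<le> card (Q `` {T x} \<inter> F `` {T x})"
      using FF(4) by (intro card_mono) auto
    moreover have "inj_on T (C `` {x} - Z)"
      using mp_automorphismD(1)[OF T] CC(2) R_space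
      by (auto simp: bij_betw_def elim!: inj_on_subset)
    moreover have "real (card (C `` {x} - Z)) = p - b"
      using CC(4)[of x] by (simp add: p_def b_def card_Diff_subset_Int of_nat_diff card_mono)
    ultimately have q: "p - b \<le> q" unfolding q_def by (simp add: card_image)
    have 1: "rel_size S F x = p / n" "rel_size Q F (T x) = q / n"
      unfolding rel_size_def p_def n_def q_def C_def Fe by (auto intro!: arg_cong[where f=card])
    have "min 1 (p / n / t) - b / p \<le> min 1 (p / n / t * (1 - b / p))"
      using np b t by (intro min_one_shrink) auto
    also have "p / n / t * (1 - b / p) = (p - b) / n / t"
      using np t by (simp add: field_simps)
    also have "min 1 ((p - b) / n / t) \<le> min 1 (q / n / t)"
      using q np t by (intro min.mono divide_right_mono) auto
    finally show ?thesis using False unfolding 1 p_def b_def by simp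
  qed
  have int_Z: "integrable M (indicator Z :: 'a \<Rightarrow> real)"
    by (rule integrable_indicator_sets[OF Z])
  \<comment> \<open>Each of the two error terms has integral \<open>measure M Z\<close>; for the
    proportion of \<open>Z\<close> in the \<open>C\<close>-classes this is
    \<open>average_integral\<close>.\<close>
  have "thickness t S F - measure M Z - measure M Z =
    (\<integral>x. min 1 (rel_size S F x / t) - indicator Z x - card (C `` {x} \<inter> Z) / card (C `` {x}) \<partial>M)"
    using min_rel_size_integrable[OF F S(1) t] average_integral[OF C Z] int_Z
    by (subst Bochner_Integration.integral_diff, simp, simp, subst Bochner_Integration.integral_diff)
       (simp_all add: thickness_def)
  also have "\<dots> \<le> (\<integral>x. min 1 (rel_size Q F (T x) / t) \<partial>M)"
  proof (rule integral_mono)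
    show "integrable M (\<lambda>x. min 1 (rel_size S F x / t) - indicator Z x - card (C `` {x} \<inter> Z) / card (C `` {x}))"
      using min_rel_size_integrable[OF F S(1) t] average_integral[OF C Z] int_Z by simp
    show "integrable M (\<lambda>x. min 1 (rel_size Q F (T x) / t))"
    proof (rule integrable_const_bound[where B=1])
      show "AE x in M. norm (min 1 (rel_size Q F (T x) / t)) \<le> 1"
        using t rel_size_nonneg by (auto simp: min_def)
    qed measurable
  qed (use pw in auto)
  also have "\<dots> = thickness t Q F"
    unfolding thickness_def by (rule mp_automorphism_integral[OF T]) measurable
  finally show ?thesis unfolding Z_def by simp
qed

text \<open>The class of \<open>x\<close> in \<open>E\<close> keeps its finite size while its
  classes in \<open>F n\<close> grow, so for fixed \<open>t\<close> the integrand tends to 0. The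
  truncation supplies the dominating function 1.\<close>

lemma thickness_tendsto_0:
  assumes E: "finite_subrel E" and F: "\<And>n. finite_subrel (F n)"
    and lim: "AE x in M. filterlim (\<lambda>n. card (F n `` {x})) at_top sequentially" and t: "0 < t"
  shows "(\<lambda>n. thickness t E (F n)) \<longlonglongrightarrow> 0"
proof -
  have "(\<lambda>n. \<integral>x. min 1 (rel_size E (F n) x / t) \<partial>M) \<longlonglongrightarrow> (\<integral>x. 0 \<partial>M)"
  proof (rule integral_dominated_convergence[where w="\<lambda>_. 1"])
    fix n
    note [measurable] = rel_size_measurable[OF F finite_subrelD(1)[OF E]]
    show "(\<lambda>x. min 1 (rel_size E (F n) x / t)) \<in> borel_measurable M" by measurable
    show "AE x in M. norm (min 1 (rel_size E (F n) x / t)) \<le> 1"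
      using t rel_size_nonneg by (auto simp: min_def)
  next
    show "AE x in M. (\<lambda>n. min 1 (rel_size E (F n) x / t)) \<longlonglongrightarrow> 0"
      using lim
    proof eventually_elim
      case (elim x)
      define k where "k = real (card (E `` {x}))"
      have "filterlim (\<lambda>n. real (card (F n `` {x}))) at_top sequentially"
        using filterlim_compose[OF filterlim_real_sequentially elim] .
      then have "(\<lambda>n. k / real (card (F n `` {x}))) \<longlonglongrightarrow> 0"
        by (intro real_tendsto_divide_at_top) auto
      then have up: "(\<lambda>n. k / real (card (F n `` {x})) / t) \<longlonglongrightarrow> 0"
        by (rule tendsto_divide_zero)
      show ?case
      proof (rule tendsto_sandwich[OF _ _ tendsto_const up])
        show "\<forall>\<^sub>F n in sequentially. 0 \<le> min 1 (rel_size E (F n) x / t)"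
          using t rel_size_nonneg by auto
        have "card (E `` {x} \<inter> F n `` {x}) \<le> card (E `` {x})" for n
          using finite_subrelD(4)[OF E] by (intro card_mono) auto
        then have "rel_size E (F n) x \<le> k / real (card (F n `` {x}))" for n
          unfolding rel_size_def k_def by (intro divide_right_mono) auto
        then show "\<forall>\<^sub>F n in sequentially. min 1 (rel_size E (F n) x / t) \<le> k / real (card (F n `` {x})) / t"
          using t by (intro always_eventually allI min.coboundedI2 divide_right_mono) auto
      qed
    qed
  qed auto
  then show ?thesis by (simp add: thickness_def)
qed

text \<open>Let \<open>A\<close> be the points of colour below \<open>K\<close> whose colour fills
  less than the proportion \<open>t\<close> of their \<open>F\<close>-class. At most
  \<open>K\<close> colours contribute to \<open>A\<close> in one class, so \<open>A\<close> has
  density at most \<open>K * t\<close> there, and by averaging also measure at most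
  \<open>K * t\<close>. Off \<open>A\<close> and off the colours from \<open>K\<close> on, the
  integrand equals 1.\<close>

lemma thickness_colouring:
  fixes c :: "'a \<Rightarrow> nat" and K :: nat and t :: real
  assumes F: "finite_subrel F" and c [measurable]: "c \<in> measurable M (count_space UNIV)" and t: "0 < t"
  shows "1 - measure M {x \<in> space M. K \<le> c x} - K * t \<le> thickness t {(x, y) \<in> R. c x = c y} F"
proof -
  note FF = finite_subrelD[OF F]
  define S where "S = {(x, y) \<in> R. c x = c y}"
  have "S = R \<inter> {p \<in> space (M \<Otimes>\<^sub>M M). c (fst p) = c (snd p)}"
    unfolding S_def using R_space by (auto simp: space_pair_measure)
  also have "\<dots> \<in> sets (M \<Otimes>\<^sub>M M)" by measurable
  finally have S: "S \<in> sets (M \<Otimes>\<^sub>M M)" .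
  note [measurable] = FF(1) rel_size_measurable[OF F S]
  define A where "A = {x \<in> space M. rel_size S F x < t \<and> c x < K}"
  have A [measurable]: "A \<in> sets M" unfolding A_def by measurable
  have bd: "card (F `` {x} \<inter> A) / card (F `` {x}) \<le> K * t" if x: "x \<in> space M" for x
  proof -
    define n where "n = real (card (F `` {x}))"
    have "x \<in> F `` {x}" using equiv_class_self x FF(3) by fast
    then have n: "n > 0" unfolding n_def using FF(4) by (auto simp: card_gt_0_iff)
    define P where "P i = {y \<in> F `` {x}. c y = i}" for i
    define I where "I = {i. i < K \<and> card (P i) \<le> t * n}"
    have "F `` {x} \<inter> A \<subseteq> (\<Union>i\<in>I. P i)"
    proof
      fix y assume y: "y \<in> F `` {x} \<inter> A"
      then have Fe: "F `` {y} = F `` {x}" using equiv_class_eq[OF FF(3)] by fastforce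
      have "S `` {y} \<inter> F `` {y} = P (c y)"
        using FF(2) by (auto simp: S_def P_def Fe[symmetric])
      then have "card (P (c y)) / n < t" using y Fe unfolding A_def rel_size_def n_def by simp
      then have "c y \<in> I" using y n by (auto simp: I_def A_def field_simps)
      then show "y \<in> (\<Union>i\<in>I. P i)" using y by (auto simp: P_def)
    qed
    moreover have fin: "finite I" "finite (P i)" for i
      using finite_subset[OF _ FF(4)[of x], of "P i"] by (auto simp: I_def P_def)
    ultimately have "card (F `` {x} \<inter> A) \<le> card (\<Union>i\<in>I. P i)" by (intro card_mono) auto
    also have "\<dots> \<le> (\<Sum>i\<in>I. card (P i))" using fin by (intro card_UN_le)
    finally have "real (card (F `` {x} \<inter> A)) \<le> (\<Sum>i\<in>I. real (card (P i)))" by (simp flip: of_nat_sum)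
    also have "\<dots> \<le> (\<Sum>i\<in>I. t * n)" by (intro sum_mono) (auto simp: I_def)
    also have "\<dots> = card I * (t * n)" by simp
    also have "\<dots> \<le> K * (t * n)"
    proof (intro mult_right_mono)
      have "card I \<le> card {..<K}" by (intro card_mono) (auto simp: I_def)
      then show "real (card I) \<le> real K" by simp
    qed (use t n in auto)
    finally show ?thesis using n unfolding n_def[symmetric] by (simp add: field_simps)
  qed
  have "measure M A = (\<integral>x. card (F `` {x} \<inter> A) / card (F `` {x}) \<partial>M)"
    by (rule average_integral(2)[OF F A, symmetric])
  also have "\<dots> \<le> (\<integral>x. K * t \<partial>M)"
    using bd average_integral(1)[OF F A] by (intro integral_mono) auto
  finally have A_le: "measure M A \<le> K * t" by (simp add: prob_space)
  define N where "N = {x \<in> space M. K \<le> c x}"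
  have N [measurable]: "N \<in> sets M" unfolding N_def by measurable
  have "1 - measure M A - measure M N = (\<integral>x. 1 - indicator A x - indicator N x \<partial>M)"
    using integrable_indicator_sets[OF A] integrable_indicator_sets[OF N]
    by (subst Bochner_Integration.integral_diff, simp, simp, subst Bochner_Integration.integral_diff)
       (simp_all add: prob_space)
  also have "\<dots> \<le> (\<integral>x. min 1 (rel_size S F x / t) \<partial>M)"
  proof (rule integral_mono)
    show "1 - indicator A x - indicator N x \<le> min 1 (rel_size S F x / t)" if "x \<in> space M" for x
    proof (cases "rel_size S F x < t")
      case True
      then have "x \<in> A \<or> x \<in> N" using that by (auto simp: A_def N_def)
      moreover have "0 \<le> min 1 (rel_size S F x / t)" using t rel_size_nonneg by auto
      moreover have "(0::real) \<le> indicator A x" "(0::real) \<le> indicator N x" by auto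
      ultimately show ?thesis by (auto simp: algebra_simps)
    next
      case False
      then have "min 1 (rel_size S F x / t) = 1" using t by (simp add: min_def)
      moreover have "(0::real) \<le> indicator A x" "(0::real) \<le> indicator N x" by auto
      ultimately show ?thesis by linarith
    qed
  qed (use min_rel_size_integrable[OF F S t] integrable_indicator_sets[OF A]
        integrable_indicator_sets[OF N] in auto)
  finally show ?thesis using A_le unfolding thickness_def N_def S_def by linarith
qed

text \<open>By Borel--Cantelli, such a fast convergent sequence stabilises on almost every finite
  class of \<open>F\<close>.\<close>

lemma thickness_tendsto:
  assumes m: "finite_measure m" "sets m = sets (rel_measure M R)" "null_sets m = null_sets (rel_measure M R)"
    and F: "finite_subrel F" and E: "E \<in> sets (M \<Otimes>\<^sub>M M)" "E \<subseteq> R"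
    and Q: "\<And>j. Q j \<in> sets (M \<Otimes>\<^sub>M M)" "\<And>j. Q j \<subseteq> R"
    and small: "\<And>j. measure m (sym_diff (Q j) E) < (1/2)^j" and t: "0 < t"
  shows "(\<lambda>j. thickness t (Q j) F) \<longlonglongrightarrow> thickness t E F"
proof -
  interpret m: finite_measure m by fact
  note FF = finite_subrelD[OF F]
  define A where "A j = sym_diff (Q j) E" for j
  have A: "A j \<in> sets m" for j using E Q unfolding A_def m(2) rel_measure_space_sets by auto
  have "summable (\<lambda>j. measure m (A j))"
    by (rule summable_comparison_test'[OF summable_geometric[of "1/2::real"], of 0])
       (use small in \<open>auto simp: A_def intro: less_imp_le\<close>)
  then have "limsup A \<in> null_sets m"
    using A by (intro borel_cantelli_limsup1) (auto simp: less_top[symmetric])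
  \<comment> \<open>The smallness in \<open>m\<close> gives no direct bound on section counts. Only
    null sets pass from \<open>m\<close> to \<open>M\<close>, hence the detour through convergence
    almost everywhere.\<close>
  then have ae: "AE x in M. limsup A `` {x} = {}"
    unfolding m(3) rel_measure_null_iff by simp
  have "(\<lambda>j. \<integral>x. min 1 (rel_size (Q j) F x / t) \<partial>M) \<longlonglongrightarrow> (\<integral>x. min 1 (rel_size E F x / t) \<partial>M)"
  proof (rule integral_dominated_convergence[where w="\<lambda>_. 1"])
    fix j
    note [measurable] = rel_size_measurable[OF F]
    show "(\<lambda>x. min 1 (rel_size E F x / t)) \<in> borel_measurable M" using E by measurable
    show "(\<lambda>x. min 1 (rel_size (Q j) F x / t)) \<in> borel_measurable M" using Q by measurable
    show "AE x in M. norm (min 1 (rel_size (Q j) F x / t)) \<le> 1"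
      using t rel_size_nonneg by (auto simp: min_def)
  next
    show "AE x in M. (\<lambda>j. min 1 (rel_size (Q j) F x / t)) \<longlonglongrightarrow> min 1 (rel_size E F x / t)"
      using ae
    proof eventually_elim
      case (elim x)
      have "\<forall>\<^sub>F j in sequentially. (x, y) \<notin> A j" for y
      proof -
        have "(x, y) \<notin> limsup A" using elim by auto
        then show ?thesis by (auto simp: limsup_INF_SUP eventually_sequentially)
      qed
      \<comment> \<open>Finiteness of the \<open>F\<close>-class allows one index for all its
        points; from there on the two integrands agree at \<open>x\<close>.\<close>
      then have "\<forall>\<^sub>F j in sequentially. \<forall>y\<in>F `` {x}. (x, y) \<notin> A j"
        using FF(4) by (intro eventually_ball_finite) auto
      then have "\<forall>\<^sub>F j in sequentially. min 1 (rel_size (Q j) F x / t) = min 1 (rel_size E F x / t)"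
      proof eventually_elim
        case (elim j)
        then have "Q j `` {x} \<inter> F `` {x} = E `` {x} \<inter> F `` {x}" by (auto simp: A_def)
        then show ?case by (simp add: rel_size_def)
      qed
      then show ?case by (rule tendsto_eventually)
    qed
  qed auto
  then show ?thesis by (simp add: thickness_def)
qed

section \<open>Measurable colourings of finite subrelations\<close>

definition code :: "nat \<Rightarrow> 'a \<Rightarrow> nat" where
  "code p x = (\<Sum>i | i < p \<and> x \<in> B i. 2 ^ i)"

lemma code_measurable [measurable]: "code p \<in> measurable M (count_space UNIV)"
proof -
  have "code p = (\<lambda>x. \<Sum>i<p. if x \<in> B i then 2 ^ i else 0)"
    unfolding code_def by (subst sum.inter_filter[symmetric]) (auto intro!: sum.cong)
  also have "\<dots> \<in> measurable M (count_space UNIV)" by measurable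
  finally show ?thesis .
qed

text \<open>\<open>code p\<close> is the binary number recording which of the first \<open>p\<close>
  separating sets contain a point, and \<open>set_encode\<close> is injective on finite
  sets.\<close>

lemma code_eq_iff: "code p x = code p y \<longleftrightarrow> (\<forall>i<p. x \<in> B i \<longleftrightarrow> y \<in> B i)"
proof
  assume "code p x = code p y"
  then have "set_encode {i. i < p \<and> x \<in> B i} = set_encode {i. i < p \<and> y \<in> B i}"
    by (simp add: code_def set_encode_def)
  then have "{i. i < p \<and> x \<in> B i} = {i. i < p \<and> y \<in> B i}"
    by (subst (asm) set_encode_eq) auto
  then show "\<forall>i<p. x \<in> B i \<longleftrightarrow> y \<in> B i" by auto
next
  assume "\<forall>i<p. x \<in> B i \<longleftrightarrow> y \<in> B i"
  then have "{i. i < p \<and> x \<in> B i} = {i. i < p \<and> y \<in> B i}" by auto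
  then show "code p x = code p y" by (simp add: code_def)
qed

text \<open>On a finite \<open>F\<close>-class some \<open>code p\<close> is injective. With the
  least such \<open>p\<close>, which depends only on the class, \<open>d\<close> names the points of
  each \<open>F\<close>-class injectively. The colour of a point is the least name in its
  \<open>E\<close>-class: as \<open>E\<close> is contained in \<open>F\<close>, different
  \<open>E\<close>-classes inside one \<open>F\<close>-class use disjoint sets of names and so have
  different minima.\<close>

lemma finite_subrel_colouring:
  assumes F: "finite_subrel F" and E: "E \<in> sets (M \<Otimes>\<^sub>M M)" "equiv (space M) E" "E \<subseteq> F"
  shows "\<exists>c \<in> measurable M (count_space UNIV). \<forall>(x, y)\<in>F. c x = (c y :: nat) \<longleftrightarrow> (x, y) \<in> E"
proof -
  note FF = finite_subrelD[OF F]
  note [measurable] = FF(1) E(1)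
  \<comment> \<open>Quantifying over indices \<open>g\<close>, \<open>h\<close> rather than over
    points of the class keeps this a countable combination of measurable conditions;
    \<open>c\<close> below is written with an index for the same reason.\<close>
  define sep where "sep x p \<longleftrightarrow> (\<forall>g h. (x, \<psi> g x) \<in> F \<longrightarrow> (x, \<psi> h x) \<in> F \<longrightarrow> \<psi> g x \<noteq> \<psi> h x \<longrightarrow>
    code p (\<psi> g x) \<noteq> code p (\<psi> h x))" for x p
  have Fy: "y \<in> F `` {x} \<longleftrightarrow> (\<exists>g. y = \<psi> g x \<and> (x, \<psi> g x) \<in> F)" for x y
    using FF(2) R_iff[of x y] by (metis Image_singleton_iff subsetD)
  have sep_iff: "sep x p \<longleftrightarrow> (\<forall>y\<in>F `` {x}. \<forall>z\<in>F `` {x}. y \<noteq> z \<longrightarrow> code p y \<noteq> code p z)" for x p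
    unfolding sep_def Ball_def Fy by blast
  define p where "p x = (LEAST p. sep x p)" for x
  have sep_ex: "\<exists>p. sep x p" for x
  proof -
    have "\<exists>i. \<not> (y \<in> B i \<longleftrightarrow> z \<in> B i)" if "y \<in> F `` {x}" "z \<in> F `` {x}" "y \<noteq> z" for y z
      using B_sep[of y z] that FF(2) R_space by blast
    then obtain i where i: "\<And>y z. y \<in> F `` {x} \<Longrightarrow> z \<in> F `` {x} \<Longrightarrow> y \<noteq> z \<Longrightarrow>
        \<not> (y \<in> B (i y z) \<longleftrightarrow> z \<in> B (i y z))" by metis
    have "finite ((\<lambda>(y, z). i y z) ` (F `` {x} \<times> F `` {x}))" using FF(4) by simp
    then obtain q where "\<forall>n\<in>(\<lambda>(y, z). i y z) ` (F `` {x} \<times> F `` {x}). n < q"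
      unfolding finite_nat_set_iff_bounded by blast
    then have q: "i y z < q" if "y \<in> F `` {x}" "z \<in> F `` {x}" for y z using that by force
    have "sep x q" unfolding sep_iff code_eq_iff using i q by meson
    then show ?thesis ..
  qed
  have sep_p: "sep x (p x)" for x unfolding p_def using sep_ex by (rule LeastI_ex)
  \<comment> \<open>Names of two points can be compared only if they are codes of the same length
    \<open>p\<close>.\<close>
  have p_const: "p x = p y" if "(x, y) \<in> F" for x y
    using equiv_class_eq[OF FF(3) that] unfolding p_def sep_iff by simp
  have [measurable]: "Measurable.pred M (\<lambda>x. sep x q)" for q unfolding sep_def by measurable
  have [measurable]: "p \<in> measurable M (count_space UNIV)" unfolding p_def by measurable
  define d where "d x = code (p x) x" for x
  have d [measurable]: "d \<in> measurable M (count_space UNIV)"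
    unfolding d_def by measurable
  have d_inj: "y = z" if "(x, y) \<in> F" "(x, z) \<in> F" "d y = d z" for x y z
  proof -
    have "p y = p x" "p z = p x" using p_const that by metis+
    then show ?thesis using sep_p[of x] that unfolding sep_iff d_def by auto
  qed
  define c where "c x = (LEAST v. \<exists>g. (x, \<psi> g x) \<in> E \<and> d (\<psi> g x) = v)" for x
  have c [measurable]: "c \<in> measurable M (count_space UNIV)" unfolding c_def by measurable
  have c_eq: "c x = (LEAST v. \<exists>y\<in>E `` {x}. d y = v)" for x
  proof -
    have "(\<exists>g. (x, \<psi> g x) \<in> E \<and> d (\<psi> g x) = v) \<longleftrightarrow> (\<exists>y\<in>E `` {x}. d y = v)" for v
      using E(3) FF(2) R_iff by (metis Image_singleton_iff subsetD)
    then show ?thesis unfolding c_def by simp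
  qed
  have c_ex: "\<exists>y\<in>E `` {x}. d y = c x" if "x \<in> space M" for x
    unfolding c_eq using equiv_class_self[OF E(2) that]
    by (intro LeastI_ex[of "\<lambda>v. \<exists>y\<in>E `` {x}. d y = v"]) auto
  have "c x = c y \<longleftrightarrow> (x, y) \<in> E" if xy: "(x, y) \<in> F" for x y
  proof
    assume "(x, y) \<in> E"
    then show "c x = c y" using equiv_class_eq[OF E(2), of x y] unfolding c_eq by simp
  next
    assume e: "c x = c y"
    have "x \<in> space M" "y \<in> space M" using xy FF(2) R_space by auto
    then obtain x' y' where x': "(x, x') \<in> E" "d x' = c x" and y': "(y, y') \<in> E" "d y' = c y"
      using c_ex by (metis Image_singleton_iff)
    have "(x, y') \<in> F" using xy y'(1) E(3) FF(3) unfolding equiv_def trans_def by blast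
    then have "x' = y'" using d_inj[of x x' y'] x' y' e E(3) by auto
    then show "(x, y) \<in> E" using x'(1) y'(1) E(2) unfolding equiv_def sym_def trans_def by blast
  qed
  then show ?thesis using c by (intro bexI[of _ c]) auto
qed

end

context pmp_rel
begin

lemma measure_ge_tendsto_0:
  assumes [measurable]: "c \<in> measurable M (count_space UNIV)"
  shows "(\<lambda>K::nat. measure M {x \<in> space M. K \<le> c x}) \<longlonglongrightarrow> 0"
proof -
  have "(\<lambda>K::nat. measure M {x \<in> space M. K \<le> c x}) \<longlonglongrightarrow> measure M (\<Inter>K::nat. {x \<in> space M. K \<le> c x})"
    by (rule finite_Lim_measure_decseq) (auto simp: decseq_def)
  moreover have "(\<Inter>K::nat. {x \<in> space M. K \<le> c x}) = {}"
  proof -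
    have "x \<notin> (\<Inter>K::nat. {x \<in> space M. K \<le> c x})" for x
      by (auto intro!: exI[of _ "Suc (c x)"])
    then show ?thesis by blast
  qed
  ultimately show ?thesis by simp
qed

subsection \<open>Ergodic and hyperfinite relations\<close>

text \<open>Otherwise, by ergodicity, almost every class has at most \<open>r\<close> points for
  some \<open>r\<close>. Take \<open>A\<close> of positive measure less than \<open>1 / r\<close>.
  Its saturation \<open>V\<close> is conull, so \<open>A\<close> takes up at least
  \<open>1 / r\<close> of almost every class, and averaging gives \<open>A\<close> measure at least
  \<open>1 / r\<close>.\<close>

lemma infinite_classes:
  assumes erg: "ergodic_rel M R" and at: "atomless M"
  shows "AE x in M. infinite (R `` {x})"
proof (rule ccontr)
  assume notAE: "\<not> ?thesis"
  define Z where "Z r = {x \<in> space M. emeasure (count_space UNIV) (R `` {x}) \<le> of_nat r}" for r :: nat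
  note [measurable] = emeasure_section_measurable[OF R_sets subset_refl]
  have Z_sets [measurable]: "Z r \<in> sets M" for r unfolding Z_def by measurable
  have Z_iff: "x \<in> Z r \<longleftrightarrow> x \<in> space M \<and> finite (R `` {x}) \<and> card (R `` {x}) \<le> r" for x r
    unfolding Z_def by (cases "finite (R `` {x})") (auto simp: emeasure_count_space top_unique)
  have "\<exists>r. Z r \<notin> null_sets M"
  proof (rule ccontr)
    assume "\<nexists>r. Z r \<notin> null_sets M"
    then have "(\<Union>r. Z r) \<in> null_sets M" by (intro null_sets_UN) auto
    then have "AE x in M. x \<notin> (\<Union>r. Z r)" by (rule AE_not_in)
    then have "AE x in M. infinite (R `` {x})"
      using AE_space by eventually_elim (auto simp: Z_iff)
    then show False using notAE by simp
  qed
  then obtain r where r: "Z r \<notin> null_sets M" by blast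
  have inv: "y \<in> Z r" if "x \<in> Z r" "(x, y) \<in> R" for x y
    using that equiv_class_eq[OF equiv_R that(2)] R_space unfolding Z_iff by auto
  have "R `` Z r \<subseteq> Z r" using inv by auto
  moreover have "Z r \<subseteq> R `` Z r"
  proof
    fix x assume "x \<in> Z r"
    moreover from this have "(x, x) \<in> R" using R_refl by (simp add: Z_iff)
    ultimately show "x \<in> R `` Z r" by blast
  qed
  ultimately have "R `` Z r = Z r" by blast
  from erg[unfolded ergodic_rel_def, rule_format, OF Z_sets this]
  have "space M - Z r \<in> null_sets M" using r by blast
  then have "AE x in M. x \<notin> space M - Z r" by (rule AE_not_in)
  then have Z1: "AE x in M. x \<in> Z r" using AE_space by eventually_elim auto
  have "Z r \<noteq> {}" using r by auto
  then obtain x0 where "x0 \<in> Z r" by blast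
  then have "R `` {x0} \<noteq> {}" "finite (R `` {x0})" "card (R `` {x0}) \<le> r" using R_refl by (auto simp: Z_iff)
  then have "0 < card (R `` {x0})" by (simp add: card_gt_0_iff)
  then have r1: "r \<ge> 1" using \<open>card (R `` {x0}) \<le> r\<close> by linarith
  \<comment> \<open>Off the invariant set \<open>Z r\<close> the relation is cut down to the
    diagonal. So \<open>C\<close> has finite classes everywhere, while almost every class is
    unchanged.\<close>
  define C where "C = (R \<inter> Z r \<times> Z r) \<union> {p \<in> space (M \<Otimes>\<^sub>M M). fst p = snd p}"
  have C_iff: "(x, y) \<in> C \<longleftrightarrow> x \<in> space M \<and> (x = y \<or> (x, y) \<in> R \<and> x \<in> Z r)" for x y
    using inv[of x y] by (auto simp: C_def space_pair_measure Z_iff)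
  have sec: "C `` {x} = R `` {x}" if "x \<in> Z r" for x
    using that R_refl by (auto simp: C_iff Z_iff)
  have C: "finite_subrel C"
  proof -
    have "C \<in> sets (M \<Otimes>\<^sub>M M)" unfolding C_def by measurable
    moreover have "C \<subseteq> R" using R_refl by (auto simp: C_iff)
    moreover have "equiv (space M) C"
    proof (rule equivI)
      show "C \<subseteq> space M \<times> space M" using R_space by (auto simp: C_iff)
      show "refl_on (space M) C" by (auto simp: refl_on_def C_iff)
      show "sym C" using R_sym inv R_space by (auto simp: sym_def C_iff)
      show "trans C" using R_trans by (auto simp: trans_def C_iff)
    qed
    moreover have "finite (C `` {x})" if "x \<in> space M" for x
    proof (cases "x \<in> Z r")
      case True then show ?thesis using sec Z_iff by simp
    next
      case False then have "C `` {x} \<subseteq> {x}" by (auto simp: C_iff)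
      then show ?thesis by (rule finite_subset) simp
    qed
    ultimately show ?thesis unfolding finite_subrel_def by blast
  qed
  obtain l :: nat where l: "(1/2::real) ^ l < 1 / r"
    using real_arch_pow_inv[of "1 / real r" "1/2"] r1 by auto
  obtain A where A [measurable]: "A \<in> sets M" and A0: "0 < measure M A" "measure M A \<le> (1/2)^l"
    using atomless_small[OF prob_space_axioms at] by blast
  define V where "V = {x \<in> space M. \<exists>g. \<psi> g x \<in> A}"
  have V_iff: "x \<in> V \<longleftrightarrow> x \<in> space M \<and> (\<exists>y\<in>A. (x, y) \<in> R)" for x
    by (auto simp: V_def R_iff)
  have V [measurable]: "V \<in> sets M" unfolding V_def by measurable
  have "R `` V \<subseteq> V"
  proof
    fix y assume "y \<in> R `` V"
    then obtain x a where xa: "(x, y) \<in> R" "a \<in> A" "(x, a) \<in> R" by (auto simp: V_iff)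
    then have "(y, a) \<in> R" using R_sym R_trans by blast
    then show "y \<in> V" using xa(2) R_space unfolding V_iff by blast
  qed
  moreover have "V \<subseteq> R `` V"
  proof
    fix x assume "x \<in> V"
    moreover from this have "(x, x) \<in> R" using R_refl by (simp add: V_iff)
    ultimately show "x \<in> R `` V" by blast
  qed
  ultimately have RV: "R `` V = V" by blast
  have V0: "V \<notin> null_sets M"
  proof
    assume "V \<in> null_sets M"
    moreover have "A \<subseteq> V"
    proof
      fix x assume x: "x \<in> A"
      then have "x \<in> space M" using sets.sets_into_space[OF A] by blast
      then show "x \<in> V" using x R_refl[of x] unfolding V_iff by blast
    qed
    ultimately have "A \<in> null_sets M" using A by (meson null_sets_subset)
    then show False using A0 by (simp add: measure_def null_sets_def)
  qed
  from erg[unfolded ergodic_rel_def, rule_format, OF V RV] V0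
  have "space M - V \<in> null_sets M" by blast
  then have "AE x in M. x \<notin> space M - V" by (rule AE_not_in)
  then have V1: "AE x in M. x \<in> V" using AE_space by eventually_elim auto
  have "1 / real r = (\<integral>x. 1 / real r \<partial>M)" by (simp add: prob_space)
  also have "\<dots> \<le> (\<integral>x. card (C `` {x} \<inter> A) / card (C `` {x}) \<partial>M)"
  proof (rule integral_mono_AE)
    show "AE x in M. 1 / real r \<le> card (C `` {x} \<inter> A) / card (C `` {x})"
      using V1 Z1
    proof eventually_elim
      case (elim x)
      have fin: "finite (C `` {x})" using finite_subrelD(4)[OF C] .
      obtain y where "y \<in> A" "(x, y) \<in> R" using elim(1) V_iff by blast
      then have "y \<in> C `` {x} \<inter> A" using sec[OF elim(2)] by auto
      then have "1 \<le> card (C `` {x} \<inter> A)" using fin by (metis One_nat_def Suc_leI card_gt_0_iff empty_iff finite_Int)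
      moreover have "card (C `` {x}) \<le> r" using elim(2) sec Z_iff by simp
      moreover have "card (C `` {x} \<inter> A) \<le> card (C `` {x})" using fin by (intro card_mono) auto
      ultimately show ?case by (intro frac_le) auto
    qed
  qed (use average_integral(1)[OF C A] in auto)
  also have "\<dots> = measure M A" by (rule average_integral(2)[OF C A])
  finally show False using A0 l by simp
qed

text \<open>The conull set \<open>Y\<close> need not be invariant, and then the given relations miss
  the points of a class outside \<open>Y\<close>. So \<open>Y\<close> is replaced by the set
  \<open>Y'\<close> of points whose whole class lies in \<open>Y\<close>; it is invariant, and
  conull because the \<open>\<psi> g\<close> are countably many automorphisms. Adding the diagonal
  makes the relations live on the whole space.\<close>

lemma hyperfinite_exhaustion:
  assumes "hyperfinite_rel M R"
  obtains F where "\<And>n::nat. finite_subrel (F n)" "incseq F" "AE x in M. (\<Union>n. F n `` {x}) = R `` {x}"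
proof -
  obtain Y F where Y: "Y \<in> sets M" "space M - Y \<in> null_sets M"
    and F0: "\<forall>n::nat. borel_equiv_rel_on M Y (F n) \<and> (\<forall>x\<in>Y. finite (F n `` {x}))"
      "incseq F" "(\<Union>n. F n) = R \<inter> Y \<times> Y"
    using assms unfolding hyperfinite_rel_def by (elim bexE conjE exE) rule
  have F: "\<And>n. F n \<in> sets (M \<Otimes>\<^sub>M M)" "\<And>n. equiv Y (F n)" "\<And>n x. x \<in> Y \<Longrightarrow> finite (F n `` {x})"
      "incseq F" "(\<Union>n. F n) = R \<inter> Y \<times> Y"
    using F0 by (simp_all add: borel_equiv_rel_on_def)
  have symF: "(x, y) \<in> F n \<Longrightarrow> (y, x) \<in> F n" for x y n
    using F(2)[of n] by (auto simp: equiv_def sym_def)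
  have transF: "(x, y) \<in> F n \<Longrightarrow> (y, z) \<in> F n \<Longrightarrow> (x, z) \<in> F n" for x y z n
    using F(2)[of n] unfolding equiv_def trans_def by blast
  note [measurable] = Y(1) F(1)
  define Y' where "Y' = {x \<in> space M. \<forall>g. \<psi> g x \<in> Y}"
  have [measurable]: "Y' \<in> sets M" unfolding Y'_def by measurable
  have Y'_iff: "x \<in> Y' \<longleftrightarrow> x \<in> space M \<and> R `` {x} \<subseteq> Y" for x
    unfolding Y'_def using R_iff[of x] by auto
  have Y'Y: "Y' \<subseteq> Y"
  proof
    fix x assume "x \<in> Y'"
    then show "x \<in> Y" using R_refl[of x] unfolding Y'_iff by blast
  qed
  have inv: "y \<in> Y'" if "x \<in> Y'" "(x, y) \<in> R" for x y
    using that equiv_class_eq[OF equiv_R that(2)] R_space unfolding Y'_iff by auto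
  have "AE x in M. x \<in> Y" using AE_not_in[OF Y(2)] AE_space by eventually_elim auto
  then have "AE x in M. \<forall>g. \<psi> g x \<in> Y"
    unfolding AE_all_countable using mp_automorphism_AE[OF aut] by blast
  then have Y'1: "AE x in M. x \<in> Y'" using AE_space by eventually_elim (auto simp: Y'_def)
  define H where "H n = (F n \<inter> Y' \<times> Y') \<union> {p \<in> space (M \<Otimes>\<^sub>M M). fst p = snd p}" for n
  have FR: "F n \<subseteq> R" for n using F(5) by blast
  then have FRD: "(x, y) \<in> F n \<Longrightarrow> (x, y) \<in> R" for x y n by blast
  have H_iff: "(x, y) \<in> H n \<longleftrightarrow> x \<in> space M \<and> (x = y \<or> (x, y) \<in> F n \<and> x \<in> Y')" for x y n
    using inv[of x y] FR[of n] by (auto simp: H_def space_pair_measure Y'_iff)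
  have "finite_subrel (H n)" for n
  proof -
    have "H n \<in> sets (M \<Otimes>\<^sub>M M)" unfolding H_def by measurable
    moreover have HR: "H n \<subseteq> R" by (auto simp: H_iff intro: R_refl FRD)
    moreover have "equiv (space M) (H n)"
    proof (rule equivI)
      show "H n \<subseteq> space M \<times> space M" using HR R_space by auto
      show "refl_on (space M) (H n)" by (auto simp: refl_on_def H_iff)
      show "sym (H n)"
      proof (rule symI)
        fix x y assume xy: "(x, y) \<in> H n"
        show "(y, x) \<in> H n"
        proof (cases "x = y")
          case False
          then have "(x, y) \<in> F n" "x \<in> Y'" using xy by (auto simp: H_iff)
          then have "(y, x) \<in> F n" "y \<in> Y'" using symF[of x y n] inv FR by blast+
          then show ?thesis by (simp add: H_iff Y'_iff)
        qed (use xy in simp)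
      qed
      show "trans (H n)"
        using transF[of _ _ n] by (auto simp: trans_def H_iff)
    qed
    moreover have "finite (H n `` {x})" for x
    proof (cases "x \<in> Y'")
      case True
      then have "H n `` {x} \<subseteq> insert x (F n `` {x})" by (auto simp: H_iff)
      moreover have "finite (insert x (F n `` {x}))" using F(3) Y'Y True by auto
      ultimately show ?thesis by (rule finite_subset)
    next
      case False then have "H n `` {x} \<subseteq> {x}" by (auto simp: H_iff)
      then show ?thesis by (rule finite_subset) simp
    qed
    ultimately show ?thesis unfolding finite_subrel_def by blast
  qed
  moreover have "incseq H"
    using F(4) unfolding incseq_def H_def by blast
  moreover have "AE x in M. (\<Union>n. H n `` {x}) = R `` {x}"
    using Y'1
  proof eventually_elim
    case (elim x)
    have "y \<in> (\<Union>n. H n `` {x}) \<longleftrightarrow> y \<in> R `` {x}" for y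
    proof
      assume "y \<in> (\<Union>n. H n `` {x})"
      then show "y \<in> R `` {x}" by (auto simp: H_iff intro: R_refl FRD)
    next
      assume y: "y \<in> R `` {x}"
      then have "(x, y) \<in> R \<inter> Y \<times> Y" using elim inv[OF elim] Y'Y by blast
      then obtain n where "(x, y) \<in> F n" using F(5) by blast
      then show "y \<in> (\<Union>n. H n `` {x})" using elim by (auto simp: H_iff Y'_iff)
    qed
    then show ?case by blast
  qed
  ultimately show ?thesis using that by blast
qed

lemma card_classes_at_top:
  assumes F: "\<And>n::nat. finite_subrel (F n)" "incseq F" and un: "AE x in M. (\<Union>n. F n `` {x}) = R `` {x}"
    and inf: "AE x in M. infinite (R `` {x})"
  shows "AE x in M. filterlim (\<lambda>n. card (F n `` {x})) at_top sequentially"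
  using un inf
proof eventually_elim
  case (elim x)
  have inc: "incseq (\<lambda>n. F n `` {x})" using F(2) by (auto simp: incseq_def)
  show ?case unfolding filterlim_at_top
  proof
    fix K
    obtain A where A: "A \<subseteq> R `` {x}" "finite A" "card A = K" using infinite_arbitrarily_large[OF elim(2)] by blast
    then obtain n where n: "A \<subseteq> F n `` {x}" using finite_subset_incseq_UN[OF inc, of A] elim(1) by auto
    have "K \<le> card (F j `` {x})" if "n \<le> j" for j
      using A(3) n incseqD[OF inc that] finite_subrelD(4)[OF F(1)] by (metis card_mono order_trans)
    then show "\<forall>\<^sub>F n in sequentially. K \<le> card (F n `` {x})" unfolding eventually_sequentially by blast
  qed
qed

subsection \<open>Action of the full group\<close>

definition moved :: "('a \<times> 'a) set \<Rightarrow> ('a \<Rightarrow> 'a) \<Rightarrow> real" where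
  "moved F T = measure M {x \<in> space M. (x, T x) \<notin> F}"

lemma moved_tendsto_0:
  assumes F: "\<And>n::nat. finite_subrel (F n)" "incseq F" and un: "AE x in M. (\<Union>n. F n `` {x}) = R `` {x}"
    and T: "T \<in> full_group M R"
  shows "(\<lambda>n. moved (F n) T) \<longlonglongrightarrow> 0"
proof -
  have aT: "mp_automorphism M T" and TR: "AE x in M. (x, T x) \<in> R" using T by (auto simp: full_group_def)
  note [measurable] = finite_subrelD(1)[OF F(1)] mp_automorphismD(2)[OF aT]
  have "(\<lambda>n. moved (F n) T) \<longlonglongrightarrow> measure M (\<Inter>n. {x \<in> space M. (x, T x) \<notin> F n})"
    unfolding moved_def by (rule finite_Lim_measure_decseq) (use F(2) in \<open>auto simp: decseq_def incseq_def\<close>)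
  moreover have "AE x in M. x \<notin> (\<Inter>n. {x \<in> space M. (x, T x) \<notin> F n})"
    using TR un by eventually_elim auto
  then have "measure M (\<Inter>n. {x \<in> space M. (x, T x) \<notin> F n}) = 0"
    by (subst prob_eq_0) auto
  ultimately show ?thesis by simp
qed

text \<open>\<open>T\<close> carries the points it moves out of their \<open>F\<close>-class onto
  those that the inverse moves out, since \<open>F\<close> is symmetric.\<close>

lemma moved_inv:
  assumes F: "finite_subrel F" and T: "mp_automorphism M T"
  shows "moved F (inv_into (space M) T) = moved F T"
proof -
  let ?S = "inv_into (space M) T"
  note FF = finite_subrelD[OF F]
  note [measurable] = FF(1) mp_automorphismD(2,3)[OF T]
  have "measure M {y \<in> space M. (y, ?S y) \<notin> F} = measure M (T -` {y \<in> space M. (y, ?S y) \<notin> F} \<inter> space M)"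
    unfolding measure_def by (subst mp_automorphism_measure_vimage[OF T]) simp_all
  also have "T -` {y \<in> space M. (y, ?S y) \<notin> F} \<inter> space M = {x \<in> space M. (x, T x) \<notin> F}"
  proof -
    have "T x \<in> space M" "?S (T x) = x" if "x \<in> space M" for x
      using that mp_automorphismD(1)[OF T] by (auto simp: bij_betw_def)
    then show ?thesis using FF(3) by (auto simp: equiv_def sym_def)
  qed
  finally show ?thesis unfolding moved_def .
qed

definition img :: "('a \<Rightarrow> 'a) \<Rightarrow> ('a \<times> 'a) set \<Rightarrow> ('a \<times> 'a) set" where
  "img T S = map_prod T T ` S \<inter> R"

text \<open>Rewriting the image as a preimage under the inverse makes it measurable and lets it
  inherit the laws of an equivalence relation.\<close>

lemma img_iff:
  assumes T: "mp_automorphism M T" and S: "S \<subseteq> space M \<times> space M"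
  shows "(x, y) \<in> img T S \<longleftrightarrow> (x, y) \<in> R \<and> (inv_into (space M) T x, inv_into (space M) T y) \<in> S"
proof -
  have b: "bij_betw T (space M) (space M)" using mp_automorphismD[OF T] by simp
  show ?thesis
  proof
    assume "(x, y) \<in> img T S"
    then show "(x, y) \<in> R \<and> (inv_into (space M) T x, inv_into (space M) T y) \<in> S"
      using S b by (auto simp: img_def bij_betw_def)
  next
    assume a: "(x, y) \<in> R \<and> (inv_into (space M) T x, inv_into (space M) T y) \<in> S"
    then have "T (inv_into (space M) T x) = x" "T (inv_into (space M) T y) = y"
      using b R_space[of x y] by (auto simp: bij_betw_inv_into_right)
    then show "(x, y) \<in> img T S" using a by (force simp: img_def)
  qed
qed

lemma img_sets:
  assumes T: "mp_automorphism M T" and S: "S \<in> sets (M \<Otimes>\<^sub>M M)"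
  shows "img T S \<in> sets (M \<Otimes>\<^sub>M M)" "img T S \<subseteq> R"
proof -
  note [measurable] = mp_automorphismD(3)[OF T] S
  have sp: "S \<subseteq> space M \<times> space M" using sets.sets_into_space[OF S] by (simp add: space_pair_measure)
  have "img T S = R \<inter> {p \<in> space (M \<Otimes>\<^sub>M M). (inv_into (space M) T (fst p), inv_into (space M) T (snd p)) \<in> S}"
    using img_iff[OF T sp] R_space by (auto simp: space_pair_measure)
  also have "\<dots> \<in> sets (M \<Otimes>\<^sub>M M)" by measurable
  finally show "img T S \<in> sets (M \<Otimes>\<^sub>M M)" .
qed (auto simp: img_def)

lemma img_equiv:
  assumes T: "mp_automorphism M T" and S: "equiv (space M) S"
  shows "equiv (space M) (img T S)"
proof -
  have sp: "S \<subseteq> space M \<times> space M" using S by (simp add: equiv_def)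
  have i: "inv_into (space M) T x \<in> space M" if "x \<in> space M" for x
    using measurable_space[OF mp_automorphismD(3)[OF T] that] .
  note I = img_iff[OF T sp]
  show ?thesis
  proof (rule equivI)
    show "img T S \<subseteq> space M \<times> space M" using R_space by (auto simp: I)
    show "refl_on (space M) (img T S)" using i R_refl S by (auto simp: refl_on_def I equiv_def)
    show "sym (img T S)" using R_sym S by (auto simp: sym_def I equiv_def)
    show "trans (img T S)" using R_trans S unfolding trans_def I equiv_def by blast
  qed
qed

text \<open>\<open>thickness_stable\<close> is used for \<open>T\<close> from \<open>S\<close> to
  its image and for the inverse from the image back to \<open>S\<close>. Intersecting with
  \<open>R\<close> in \<open>img\<close> does no harm, since only pairs landing in \<open>F\<close>
  are tested.\<close>

lemma thickness_img:
  assumes F: "finite_subrel F" and S: "S \<in> sets (M \<Otimes>\<^sub>M M)" "equiv (space M) S"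
    and T: "mp_automorphism M T" and t: "0 < t"
  shows "\<bar>thickness t (img T S) F - thickness t S F\<bar> \<le> 2 * moved F T"
proof -
  have sp: "S \<subseteq> space M \<times> space M" using S by (simp add: equiv_def)
  have 1: "thickness t S F - 2 * moved F T \<le> thickness t (img T S) F"
    unfolding moved_def
  proof (rule thickness_stable[OF F S T img_sets(1)[OF T S(1)] _ t])
    show "(T x, T y) \<in> img T S" if "(x, y) \<in> S" "(T x, T y) \<in> F" for x y
      using that finite_subrelD(2)[OF F] by (force simp: img_def)
  qed
  have "thickness t (img T S) F - 2 * moved F (inv_into (space M) T) \<le> thickness t S F"
    unfolding moved_def
    by (rule thickness_stable[OF F img_sets(1)[OF T S(1)] img_equiv[OF T S(2)] mp_automorphism_inv[OF T] S(1) _ t])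
       (simp add: img_iff[OF T sp])
  then show ?thesis using 1 moved_inv[OF F T] by linarith
qed

text \<open>On such a piece and for \<open>n \<ge> N\<close> the thickness changes by at most
  \<open>1/10\<close> under each element, hence by at most \<open>1/5\<close> between two elements.
  This is less than the gap \<open>1/2\<close> between the two extensions below.\<close>

definition near_F :: "(nat \<Rightarrow> ('a \<times> 'a) set) \<Rightarrow> nat \<Rightarrow> ('a \<Rightarrow> 'a) set" where
  "near_F F N = {T \<in> full_group M R. \<forall>n\<ge>N. moved (F n) T \<le> 1/20}"

text \<open>The two extensions of the trace of \<open>S\<^sub>1\<close> on \<open>F k\<close> are the trace itself, whose
  classes occupy a negligible part of most \<open>F n\<close>-classes, and the equivalence relation of
  having the same colour, whose classes fill them up to few colours.\<close>

lemma two_extensions: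
  assumes m: "finite_measure m" "sets m = sets (rel_measure M R)" "null_sets m = null_sets (rel_measure M R)"
    and F: "\<And>n::nat. finite_subrel (F n)"
    and lim: "AE x in M. filterlim (\<lambda>n. card (F n `` {x})) at_top sequentially"
    and S0: "S0 \<in> sets (M \<Otimes>\<^sub>M M)" "equiv (space M) S0"
    and S1: "S1 \<in> sets (M \<Otimes>\<^sub>M M)" "equiv (space M) S1"
  shows "\<exists>E. E \<in> sets (M \<Otimes>\<^sub>M M) \<and> equiv (space M) E \<and> E \<subseteq> R \<and> E \<inter> F k = S1 \<inter> F k \<and>
    (\<exists>\<delta>>0. \<forall>T\<in>near_F F N. \<delta> \<le> measure m (sym_diff (img T S0) E))"
proof (rule ccontr)
  assume contra: "\<not> ?thesis"
  \<comment> \<open>By contradiction every extension with the prescribed trace is a limit of images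
    under the piece; the geometric rate is the one required by
    \<open>thickness_tendsto\<close>.\<close>
  have approx: "\<exists>T. \<forall>j. T j \<in> near_F F N \<and> measure m (sym_diff (img (T j) S0) E) < (1/2)^j"
    if "E \<in> sets (M \<Otimes>\<^sub>M M)" "equiv (space M) E" "E \<subseteq> R" "E \<inter> F k = S1 \<inter> F k" for E
  proof -
    have "\<exists>T\<in>near_F F N. measure m (sym_diff (img T S0) E) < \<delta>" if "\<delta> > 0" for \<delta>
      using contra \<open>E \<in> _\<close> \<open>equiv _ E\<close> \<open>E \<subseteq> R\<close> \<open>E \<inter> F k = _\<close> \<open>\<delta> > 0\<close> by (meson not_less)
    then have "\<forall>j. \<exists>T. T \<in> near_F F N \<and> measure m (sym_diff (img T S0) E) < (1/2)^j"
      by (metis zero_less_power half_gt_zero zero_less_one)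
    then show ?thesis by (rule choice)
  qed
  have aut_near: "mp_automorphism M T" if "T \<in> near_F F N" for T
    using that by (simp add: near_F_def full_group_def)
  define E where "E = S1 \<inter> F k"
  have E: "finite_subrel E" unfolding E_def by (rule finite_subrel_Int[OF F S1])
  note EE = finite_subrelD[OF E]
  obtain c where c [measurable]: "c \<in> measurable M (count_space UNIV)"
    and cE: "\<And>x y. (x, y) \<in> F k \<Longrightarrow> c x = (c y :: nat) \<longleftrightarrow> (x, y) \<in> E"
    using finite_subrel_colouring[OF F EE(1,3), of k] unfolding E_def by blast
  define S where "S = {(x, y) \<in> R. c x = c y}"
  have "S = R \<inter> {p \<in> space (M \<Otimes>\<^sub>M M). c (fst p) = c (snd p)}"
    unfolding S_def using R_space by (auto simp: space_pair_measure)
  also have "\<dots> \<in> sets (M \<Otimes>\<^sub>M M)" by measurable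
  finally have S_sets: "S \<in> sets (M \<Otimes>\<^sub>M M)" .
  have S_eq: "equiv (space M) S"
  proof (rule equivI)
    show "S \<subseteq> space M \<times> space M" using R_space by (auto simp: S_def)
    show "refl_on (space M) S" using R_refl by (auto simp: refl_on_def S_def)
    show "sym S" using R_sym by (auto simp: sym_def S_def)
    show "trans S" using R_trans by (auto simp: trans_def S_def)
  qed
  have SR: "S \<subseteq> R" by (auto simp: S_def)
  have S_tr: "S \<inter> F k = S1 \<inter> F k"
    using cE finite_subrelD(2)[OF F, of k] by (auto simp: S_def E_def)
  have E_tr: "E \<inter> F k = S1 \<inter> F k" by (auto simp: E_def)
  have "\<forall>\<^sub>F K in sequentially. measure M {x \<in> space M. K \<le> c x} < 1/8"
    by (rule order_tendstoD(2)[OF measure_ge_tendsto_0[OF c]]) simp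
  then obtain K where K: "measure M {x \<in> space M. K \<le> c x} < 1/8"
    unfolding eventually_sequentially by blast
  \<comment> \<open>The colours from \<open>K\<close> on cost less than \<open>1/8\<close> and the
    small colour classes at most \<open>K * t \<le> 1/8\<close>, which leaves more than
    \<open>3/4\<close>. The summand 1 keeps \<open>t\<close> positive whatever \<open>K\<close>
    is.\<close>
  define t :: real where "t = 1 / (8 * (real K + 1))"
  have t: "0 < t" unfolding t_def by simp
  have Kt: "K * t \<le> 1/8" unfolding t_def by (simp add: field_simps)
  have big: "3/4 < thickness t S (F n)" for n
    using thickness_colouring[OF F c t, of K n] K Kt unfolding S_def by simp
  have "\<forall>\<^sub>F n in sequentially. thickness t E (F n) < 1/4"
    by (rule order_tendstoD(2)[OF thickness_tendsto_0[OF E F lim t]]) simp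
  \<comment> \<open>One index serves both extensions: \<open>big\<close> holds for every
    \<open>n\<close>, and \<open>n \<ge> N\<close> brings it into the range controlled by
    \<open>near_F\<close>.\<close>
  then obtain n where n: "N \<le> n" "thickness t E (F n) < 1/4"
    unfolding eventually_sequentially by (metis nle_le)
  obtain T where T: "\<And>j. T j \<in> near_F F N" "\<And>j. measure m (sym_diff (img (T j) S0) E) < (1/2)^j"
    using approx[OF EE(1,3,2) E_tr] by blast
  have "(\<lambda>j. thickness t (img (T j) S0) (F n)) \<longlonglongrightarrow> thickness t E (F n)"
    using T(2) img_sets[OF aut_near[OF T(1)] S0(1)]
    by (intro thickness_tendsto[OF m F EE(1,2) _ _ _ t]) auto
  then have "\<forall>\<^sub>F j in sequentially. thickness t (img (T j) S0) (F n) < 1/4"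
    using n(2) by (rule order_tendstoD(2))
  then obtain j where j: "thickness t (img (T j) S0) (F n) < 1/4"
    unfolding eventually_sequentially by blast
  have Tj: "\<bar>thickness t (img (T j) S0) (F n) - thickness t S0 (F n)\<bar> \<le> 2 * moved (F n) (T j)"
    by (rule thickness_img[OF F S0 aut_near[OF T(1)] t])
  have mj: "moved (F n) (T j) \<le> 1/20" using T(1)[of j] n(1) by (auto simp: near_F_def)
  obtain U where U: "\<And>j. U j \<in> near_F F N" "\<And>j. measure m (sym_diff (img (U j) S0) S) < (1/2)^j"
    using approx[OF S_sets S_eq SR S_tr] by blast
  have "(\<lambda>j. thickness t (img (U j) S0) (F n)) \<longlonglongrightarrow> thickness t S (F n)"
    using U(2) img_sets[OF aut_near[OF U(1)] S0(1)]
    by (intro thickness_tendsto[OF m F S_sets SR _ _ _ t]) auto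
  then have "\<forall>\<^sub>F j in sequentially. 3/4 < thickness t (img (U j) S0) (F n)"
    using big by (rule order_tendstoD(1))
  then obtain i where i: "3/4 < thickness t (img (U i) S0) (F n)"
    unfolding eventually_sequentially by blast
  have Ui: "\<bar>thickness t (img (U i) S0) (F n) - thickness t S0 (F n)\<bar> \<le> 2 * moved (F n) (U i)"
    by (rule thickness_img[OF F S0 aut_near[OF U(1)] t])
  have mi: "moved (F n) (U i) \<le> 1/20" using U(1)[of i] n(1) by (auto simp: near_F_def)
  \<comment> \<open>The thickness of \<open>S0\<close> in \<open>F n\<close> would be both below
    \<open>1/4 + 1/10\<close> and above \<open>3/4 - 1/10\<close>.\<close>
  show False using i j Tj Ui mi mj by linarith
qed

end

section \<open>Nowhere dense pieces of an orbit\<close>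

text \<open>A point of \<open>S\<close> at positive distance from \<open>C\<close> is outside the
  closure of \<open>C\<close>. If every ball around a point of \<open>S\<close> contains such a
  point, the closure has no interior.\<close>

lemma nowhere_dense_in_metric_subspace:
  assumes X: "Metric_space X d" and S: "S \<subseteq> X" and C: "C \<subseteq> S"
    and far: "\<And>x r. x \<in> S \<Longrightarrow> 0 < r \<Longrightarrow> \<exists>y\<in>S. d x y < r \<and> (\<exists>\<delta>>0. \<forall>c\<in>C. \<delta> \<le> d y c)"
  shows "nowhere_dense_in (subtopology (Metric_space.mtopology X d) S) C"
proof -
  interpret Metric_space X d by fact
  let ?T = "subtopology mtopology S"
  have ts: "topspace ?T = S" using S by auto
  have "?T interior_of (?T closure_of C) = {}"
  proof (rule ccontr)
    assume "?T interior_of (?T closure_of C) \<noteq> {}"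
    then obtain x where x: "x \<in> ?T interior_of (?T closure_of C)" by blast
    have "openin ?T (?T interior_of (?T closure_of C))" by simp
    then obtain U where U: "openin mtopology U" "?T interior_of (?T closure_of C) = U \<inter> S"
      unfolding openin_subtopology by blast
    then have "x \<in> U" "x \<in> S" using x by auto
    then obtain r where r: "0 < r" "mball x r \<subseteq> U" using U(1) unfolding openin_mtopology by blast
    obtain y \<delta> where y: "y \<in> S" "d x y < r" and \<delta>: "0 < \<delta>" "\<And>c. c \<in> C \<Longrightarrow> \<delta> \<le> d y c"
      using far[OF \<open>x \<in> S\<close> r(1)] by blast
    have "y \<in> mball x r" using y \<open>x \<in> S\<close> S by auto
    then have "y \<in> ?T closure_of C"
      using r(2) U(2) y(1) interior_of_subset[of ?T "?T closure_of C"] by blast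
    then have "\<forall>V. y \<in> V \<and> openin ?T V \<longrightarrow> (\<exists>c. c \<in> C \<and> c \<in> V)"
      unfolding in_closure_of by (rule conjunct2)
    moreover have "openin ?T (mball y \<delta> \<inter> S)" by (auto simp: openin_subtopology)
    moreover have "y \<in> mball y \<delta> \<inter> S" using y(1) S \<delta>(1) by auto
    ultimately obtain c where "c \<in> C" "c \<in> mball y \<delta> \<inter> S" by meson
    then show False using \<delta>(2)[of c] by auto
  qed
  then show ?thesis using C ts unfolding nowhere_dense_in_def by simp
qed

section \<open>The metric of the measure algebra\<close>

lemma equiv_null_diff_rel: "equiv (sets N) (null_diff_rel N)"
proof (rule equivI)
  show "null_diff_rel N \<subseteq> sets N \<times> sets N" "refl_on (sets N) (null_diff_rel N)"
    by (auto simp: null_diff_rel_def refl_on_def)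
  show "sym (null_diff_rel N)" by (auto simp: null_diff_rel_def sym_def Un_commute)
  show "trans (null_diff_rel N)"
  proof (rule transI)
    fix A B C assume "(A, B) \<in> null_diff_rel N" "(B, C) \<in> null_diff_rel N"
    then have s: "A \<in> sets N" "C \<in> sets N" and n: "sym_diff A B \<union> sym_diff B C \<in> null_sets N"
      by (auto simp: null_diff_rel_def intro: null_sets.Un)
    have "sym_diff A C \<in> null_sets N" by (rule null_sets_subset[OF n]) (use s in auto)
    then show "(A, C) \<in> null_diff_rel N" using s by (simp add: null_diff_rel_def)
  qed
qed

lemma (in finite_measure) sym_diff_triangle:
  assumes "A \<in> sets M" "B \<in> sets M" "C \<in> sets M"
  shows "measure M (sym_diff A C) \<le> measure M (sym_diff A B) + measure M (sym_diff B C)"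
proof -
  have "measure M (sym_diff A C) \<le> measure M (sym_diff A B \<union> sym_diff B C)"
    using assms by (intro finite_measure_mono) auto
  also have "\<dots> \<le> measure M (sym_diff A B) + measure M (sym_diff B C)"
    using assms by (intro measure_Un_le) auto
  finally show ?thesis .
qed

text \<open>The representatives picked by \<open>SOME\<close> are at distance 0 from
  \<open>A\<close> and \<open>B\<close>, so the triangle inequality gives both estimates. From here
  on the choice no longer appears.\<close>

lemma malg_dist_class:
  assumes m: "finite_measure m" "sets m = sets N" "null_sets m = null_sets N"
    and A: "A \<in> sets N" and B: "B \<in> sets N"
  shows "malg_dist m (null_diff_rel N `` {A}) (null_diff_rel N `` {B}) = measure m (sym_diff A B)"
proof -
  interpret finite_measure m by fact
  have 1: "(A, SOME X. X \<in> null_diff_rel N `` {A}) \<in> null_diff_rel N" if "A \<in> sets N" for A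
    using someI[of "\<lambda>X. X \<in> null_diff_rel N `` {A}", OF equiv_class_self[OF equiv_null_diff_rel that]] by simp
  have 2: "measure m (sym_diff A X) = 0" "measure m (sym_diff X A) = 0" "A \<in> sets m" "X \<in> sets m"
    if "(A, X) \<in> null_diff_rel N" for A X
  proof -
    have "sym_diff A X \<in> null_sets m" "A \<in> sets m" "X \<in> sets m"
      using that m by (auto simp: null_diff_rel_def)
    moreover have "sym_diff X A = sym_diff A X" by auto
    ultimately show "measure m (sym_diff A X) = 0" "measure m (sym_diff X A) = 0" "A \<in> sets m" "X \<in> sets m"
      by (simp_all add: measure_eq_0_null_sets)
  qed
  define A' B' where "A' = (SOME X. X \<in> null_diff_rel N `` {A})" and "B' = (SOME X. X \<in> null_diff_rel N `` {B})"
  note A' = 2[OF 1[OF A], folded A'_def] and B' = 2[OF 1[OF B], folded B'_def]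
  have "measure m (sym_diff A' B') \<le> measure m (sym_diff A B)"
    using sym_diff_triangle[of A' A B'] sym_diff_triangle[of A B B'] A' B' by simp
  moreover have "measure m (sym_diff A B) \<le> measure m (sym_diff A' B')"
    using sym_diff_triangle[of A A' B] sym_diff_triangle[of A' B' B] A' B' by simp
  ultimately show ?thesis unfolding malg_dist_def A'_def B'_def by simp
qed

lemma malg_metric_space:
  assumes m: "finite_measure m" "sets m = sets N" "null_sets m = null_sets N"
  shows "Metric_space (malg N) (malg_dist m)"
proof
  interpret finite_measure m by fact
  note D = malg_dist_class[OF m]
  have rep: "\<exists>A\<in>sets N. x = null_diff_rel N `` {A}" if "x \<in> malg N" for x
    using that unfolding malg_def by (auto elim!: quotientE)
  have null_iff: "measure m X = 0 \<longleftrightarrow> X \<in> null_sets m" if "X \<in> sets m" for X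
    using that by (auto simp: null_sets_def emeasure_eq_measure)
  fix x y z
  show "0 \<le> malg_dist m x y" by (simp add: malg_dist_def)
  show "malg_dist m x y = malg_dist m y x" by (simp add: malg_dist_def Un_commute)
  show "malg_dist m x y = 0 \<longleftrightarrow> x = y" if xy: "x \<in> malg N" "y \<in> malg N"
  proof -
    obtain A B where AB: "A \<in> sets N" "x = null_diff_rel N `` {A}" "B \<in> sets N" "y = null_diff_rel N `` {B}"
      using rep xy by meson
    have "malg_dist m x y = 0 \<longleftrightarrow> sym_diff A B \<in> null_sets m"
      unfolding AB(2,4) D[OF AB(1,3)] using AB(1,3) m(2) null_iff by simp
    also have "\<dots> \<longleftrightarrow> (A, B) \<in> null_diff_rel N"
      using AB m(3) by (simp add: null_diff_rel_def)
    also have "\<dots> \<longleftrightarrow> x = y"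
      using eq_equiv_class_iff[OF equiv_null_diff_rel AB(1,3)] AB by simp
    finally show ?thesis .
  qed
  show "malg_dist m x z \<le> malg_dist m x y + malg_dist m y z"
    if xyz: "x \<in> malg N" "y \<in> malg N" "z \<in> malg N"
  proof -
    obtain A B C where "A \<in> sets N" "x = null_diff_rel N `` {A}" "B \<in> sets N" "y = null_diff_rel N `` {B}"
      "C \<in> sets N" "z = null_diff_rel N `` {C}"
      using rep xyz by meson
    then show ?thesis using sym_diff_triangle[of A B C] m(2) by (simp add: D)
  qed
qed

section \<open>Covering an orbit by countably many nowhere dense pieces\<close>

context pmp_rel
begin

abbreviation cls :: "('a \<times> 'a) set \<Rightarrow> ('a \<times> 'a) set set" where
  "cls S \<equiv> null_diff_rel (rel_measure M R) `` {S}"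

text \<open>The union in \<open>full_group_act\<close> runs over equal classes: if \<open>S\<close>
  and \<open>S'\<close> differ by a null set, a pair on which their images differ comes from a pair
  over \<open>inv_into (space M) T x\<close> on which \<open>S\<close> and \<open>S'\<close> differ,
  and the inverse preserves the measure.\<close>

lemma act_class:
  assumes T: "mp_automorphism M T" and S: "S \<in> sets (M \<Otimes>\<^sub>M M)" "S \<subseteq> R"
  shows "full_group_act M R T (cls S) = cls (img T S)"
proof -
  have "cls (img T S') = cls (img T S)" if S': "S' \<in> cls S" for S'
  proof -
    have S'2: "S' \<in> sets (M \<Otimes>\<^sub>M M)" "S' \<subseteq> R" and n: "sym_diff S S' \<in> null_sets (rel_measure M R)"
      using S' by (auto simp: null_diff_rel_def rel_measure_space_sets)
    have sp: "S \<subseteq> space M \<times> space M" "S' \<subseteq> space M \<times> space M"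
      using S(2) S'2(2) R_space by auto
    have "AE x in M. sym_diff S S' `` {x} = {}" using n by (simp add: rel_measure_null_iff)
    then have "AE x in M. sym_diff S S' `` {inv_into (space M) T x} = {}"
      by (rule mp_automorphism_AE[OF mp_automorphism_inv[OF T]])
    then have "AE x in M. sym_diff (img T S) (img T S') `` {x} = {}"
      by eventually_elim (use img_iff[OF T sp(1)] img_iff[OF T sp(2)] in blast)
    then have "sym_diff (img T S) (img T S') \<in> null_sets (rel_measure M R)"
      using img_sets[OF T S(1)] img_sets[OF T S'2(1)] by (auto simp: rel_measure_null_iff)
    then have "(img T S, img T S') \<in> null_diff_rel (rel_measure M R)"
      using img_sets[OF T S(1)] img_sets[OF T S'2(1)] by (auto simp: null_diff_rel_def rel_measure_space_sets)
    then show ?thesis using equiv_class_eq[OF equiv_null_diff_rel] by metis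
  qed
  moreover have "S \<in> cls S"
    by (rule equiv_class_self[OF equiv_null_diff_rel]) (use S in \<open>simp add: rel_measure_space_sets\<close>)
  ultimately show ?thesis unfolding full_group_act_def img_def[symmetric] by blast
qed

lemma orbit_meager:
  assumes erg: "ergodic_rel M R" and at: "atomless M" and hyp: "hyperfinite_rel M R"
    and m: "finite_measure m" "sets m = sets (rel_measure M R)" "null_sets m = null_sets (rel_measure M R)"
    and s: "s \<in> Sub_rel M R"
  shows "meager_in (Sub_topology M R m) (full_group_orbit M R s)"
proof -
  interpret m: finite_measure m by fact
  obtain F where F: "\<And>n::nat. finite_subrel (F n)" "incseq F"
    and un: "AE x in M. (\<Union>n. F n `` {x}) = R `` {x}"
    using hyperfinite_exhaustion[OF hyp] by blast
  note lim = card_classes_at_top[OF F un infinite_classes[OF erg at]]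
  obtain S0 where S0: "S0 \<in> sets (M \<Otimes>\<^sub>M M)" "equiv (space M) S0" "S0 \<subseteq> R" "s = cls S0"
    using s unfolding Sub_rel_def borel_equiv_rel_on_def by blast
  have Sub_malg: "Sub_rel M R \<subseteq> malg (rel_measure M R)"
    unfolding Sub_rel_def malg_def borel_equiv_rel_on_def
    by (auto intro!: quotientI simp: rel_measure_space_sets)
  note dist = malg_dist_class[OF m]
  \<comment> \<open>Relations with the same trace on \<open>F k\<close> differ only inside
    \<open>R - F k\<close>. Finiteness of \<open>m\<close> makes these sets small, although their
    counting measure is infinite; so agreement on a large \<open>F k\<close> means closeness in the
    metric.\<close>
  have tail: "(\<lambda>k. measure m (R - F k)) \<longlonglongrightarrow> 0"
  proof -
    have RF: "R - F k \<in> sets m" for k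
      using R_sets finite_subrelD(1)[OF F(1)] unfolding m(2) rel_measure_space_sets by auto
    have "(\<lambda>k. measure m (R - F k)) \<longlonglongrightarrow> measure m (\<Inter>k. R - F k)"
      by (rule m.finite_Lim_measure_decseq) (use F(2) RF in \<open>auto simp: decseq_def incseq_def\<close>)
    moreover have "(\<Inter>k. R - F k) \<in> null_sets (rel_measure M R)"
      unfolding rel_measure_null_iff
    proof (intro conjI)
      show "(\<Inter>k. R - F k) \<in> sets (M \<Otimes>\<^sub>M M)"
        using R_sets finite_subrelD(1)[OF F(1)] by (intro sets.countable_INT') auto
      show "AE x in M. (\<Inter>k. R - F k) `` {x} = {}"
        using un by eventually_elim auto
    qed auto
    then have "measure m (\<Inter>k. R - F k) = 0" using m(3) measure_eq_0_null_sets by blast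
    ultimately show ?thesis by simp
  qed
  define C where "C N = (\<lambda>T. cls (img T S0)) ` near_F F N" for N
  have "full_group_orbit M R s = (\<lambda>T. cls (img T S0)) ` full_group M R"
    unfolding full_group_orbit_def S0(4)
    by (intro image_cong) (auto simp: full_group_def act_class[OF _ S0(1,3)])
  also have "full_group M R = (\<Union>N. near_F F N)"
  proof -
    have "\<exists>N. T \<in> near_F F N" if T: "T \<in> full_group M R" for T
    proof -
      have "\<forall>\<^sub>F n in sequentially. moved (F n) T < 1/20"
        by (rule order_tendstoD(2)[OF moved_tendsto_0[OF F un T]]) simp
      then show ?thesis using T unfolding eventually_sequentially near_F_def by (auto intro: less_imp_le)
    qed
    then show ?thesis by (auto simp: near_F_def)
  qed
  finally have orbit_eq: "full_group_orbit M R s = (\<Union>N. C N)" by (auto simp: C_def)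
  have "nowhere_dense_in (Sub_topology M R m) (C N)" for N
    unfolding Sub_topology_def malg_topology_def
  proof (rule nowhere_dense_in_metric_subspace[OF malg_metric_space[OF m] Sub_malg])
    have "mp_automorphism M T" if "T \<in> near_F F N" for T
      using that by (simp add: near_F_def full_group_def)
    then show "C N \<subseteq> Sub_rel M R"
      using img_sets[OF _ S0(1)] img_equiv[OF _ S0(2)]
      unfolding C_def Sub_rel_def borel_equiv_rel_on_def by blast
    fix x r assume x: "x \<in> Sub_rel M R" and r: "(0::real) < r"
    obtain S1 where S1: "S1 \<in> sets (M \<Otimes>\<^sub>M M)" "equiv (space M) S1" "S1 \<subseteq> R" "x = cls S1"
      using x unfolding Sub_rel_def borel_equiv_rel_on_def by blast
    obtain k where k: "measure m (R - F k) < r"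
      using order_tendstoD(2)[OF tail r] unfolding eventually_sequentially by blast
    obtain E \<delta> where E: "E \<in> sets (M \<Otimes>\<^sub>M M)" "equiv (space M) E" "E \<subseteq> R" "E \<inter> F k = S1 \<inter> F k"
      and \<delta>: "0 < \<delta>" "\<And>T. T \<in> near_F F N \<Longrightarrow> \<delta> \<le> measure m (sym_diff (img T S0) E)"
      using two_extensions[OF m F(1) lim S0(1,2) S1(1,2), of k N] by blast
    have sN: "S \<in> sets (rel_measure M R)" if "S \<in> sets (M \<Otimes>\<^sub>M M)" "S \<subseteq> R" for S
      using that by (simp add: rel_measure_space_sets)
    show "\<exists>y\<in>Sub_rel M R. malg_dist m x y < r \<and> (\<exists>\<delta>>0. \<forall>c\<in>C N. \<delta> \<le> malg_dist m y c)"
    proof (intro bexI[of _ "cls E"] conjI exI[of _ \<delta>] ballI)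
      show "cls E \<in> Sub_rel M R" using E unfolding Sub_rel_def borel_equiv_rel_on_def by blast
      have "malg_dist m x (cls E) = measure m (sym_diff S1 E)"
        unfolding S1(4) using dist[OF sN[OF S1(1,3)] sN[OF E(1,3)]] .
      also have "\<dots> \<le> measure m (R - F k)"
      proof (rule m.finite_measure_mono)
        show "sym_diff S1 E \<subseteq> R - F k" using S1(3) E(3,4) by blast
        show "R - F k \<in> sets m"
          using R_sets finite_subrelD(1)[OF F(1)] unfolding m(2) rel_measure_space_sets by auto
      qed
      finally show "malg_dist m x (cls E) < r" using k by simp
    next
      fix c assume "c \<in> C N"
      then obtain T where T: "T \<in> near_F F N" "c = cls (img T S0)" by (auto simp: C_def)
      then have aT: "mp_automorphism M T" by (simp add: near_F_def full_group_def)
      have "malg_dist m (cls E) c = measure m (sym_diff E (img T S0))"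
        unfolding T(2) using dist[OF sN[OF E(1,3)] sN[OF img_sets[OF aT S0(1)]]] .
      then show "\<delta> \<le> malg_dist m (cls E) c" using \<delta>(2)[OF T(1)] by (simp add: Un_commute)
    qed (rule \<delta>(1))
  qed
  then show ?thesis unfolding meager_in_def orbit_eq by blast
qed

end

section \<open>From a countable group action to a sequence of automorphisms\<close>

lemma pmp_equiv_rel_imp_pmp_rel:
  fixes M :: "'a measure"
  assumes M: "prob_space M" "standard_borel_measure M" and R: "pmp_equiv_rel M R"
  obtains \<psi> B where "pmp_rel M R \<psi> B"
proof -
  obtain G :: "nat monoid" and \<phi> where G: "group_action G (space M) \<phi>"
    and \<phi>: "\<And>g. g \<in> carrier G \<Longrightarrow> mp_automorphism M (\<phi> g)"
    and R_eq: "R = {(x, y). x \<in> space M \<and> y \<in> orbit G \<phi> x}"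
    using R unfolding pmp_equiv_rel_def by blast
  interpret group_action G "space M" \<phi> by fact
  have one: "\<one>\<^bsub>G\<^esub> \<in> carrier G"
    using group_hom group_hom.axioms(1) group.is_monoid monoid.one_closed by blast
  \<comment> \<open>Numbers outside the carrier are given the action of the unit, so all of
    \<open>nat\<close> serves as index set and the graphs still cover exactly
    \<open>R\<close>.\<close>
  define \<psi> where "\<psi> n = (if n \<in> carrier G then \<phi> n else \<phi> \<one>\<^bsub>G\<^esub>)" for n
  obtain B :: "nat \<Rightarrow> 'a set" where B: "\<And>i. B i \<in> sets M"
    "\<And>x y. x \<in> space M \<Longrightarrow> y \<in> space M \<Longrightarrow> x \<noteq> y \<Longrightarrow> \<exists>i. x \<in> B i \<and> y \<notin> B i"
    by (rule standard_borel_separating[OF M(2)]) (rule that)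
  have sp: "y \<in> space M" if "x \<in> space M" "y \<in> orbit G \<phi> x" for x y
    using that element_image by (auto simp: orbit_def)
  have "equiv (space M) R"
  proof (rule equivI)
    show "R \<subseteq> space M \<times> space M" using sp by (auto simp: R_eq)
    show "refl_on (space M) R" using orbit_refl by (auto simp: refl_on_def R_eq)
    show "sym R" using orbit_sym sp by (auto simp: sym_def R_eq)
    show "trans R"
    proof (rule transI)
      fix x y z assume "(x, y) \<in> R" "(y, z) \<in> R"
      then show "(x, z) \<in> R" using orbit_trans[of x y z] sp[of x y] sp[of y z] by (simp add: R_eq)
    qed
  qed
  moreover have "R = {(x, \<psi> g x) | x g. x \<in> space M}"
  proof -
    have "y \<in> orbit G \<phi> x \<longleftrightarrow> (\<exists>g. y = \<psi> g x)" for x y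
      using one unfolding orbit_def \<psi>_def by auto
    then show ?thesis unfolding R_eq by auto
  qed
  ultimately have "pmp_rel M R \<psi> B"
    using M(1) B \<phi> one by (auto simp: pmp_rel_def pmp_rel_axioms_def \<psi>_def)
  then show ?thesis by (rule that)
qed

theorem theorem4:
  fixes M :: "'a measure" and R0 :: "('a \<times> 'a) set" and m :: "('a \<times> 'a) measure"
  assumes "standard_prob_space M"
    and "pmp_equiv_rel M R0" and "ergodic_rel M R0" and "hyperfinite_rel M R0"
    and "finite_measure m" and "sets m = sets (rel_measure M R0)"
    and "null_sets m = null_sets (rel_measure M R0)"
  shows "\<forall>s\<in>Sub_rel M R0. meager_in (Sub_topology M R0 m) (full_group_orbit M R0 s)"
proof
  fix s assume s: "s \<in> Sub_rel M R0"
  have M: "prob_space M" "standard_borel_measure M" "atomless M"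
    using assms(1) by (auto simp: standard_prob_space_def)
  obtain \<psi> B where "pmp_rel M R0 \<psi> B"
    using pmp_equiv_rel_imp_pmp_rel[OF M(1,2) assms(2)] .
  then interpret pmp_rel M R0 \<psi> B .
  show "meager_in (Sub_topology M R0 m) (full_group_orbit M R0 s)"
    by (rule orbit_meager[OF assms(3) M(3) assms(4-7) s])
qed

end
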